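(* Let $\lambda$ be an infinite regular cardinal and suppose that $\clubsuit_{\mathrm{AD}}(\{E^{\lambda^+}_{\lambda}\},\lambda,1)$ holds. Then there exists a collectionwise normal Dowker space $\mathbb X$ of cardinality $\lambda^+$ such that $\mathrm{hd}(\mathbb X)=\lambda$ and $\mathrm{L}(\mathbb X)=\lambda^+$.
   Context: All topological spaces are assumed $T_1$ and Hausdorff. A Dowker space is a normal space whose product with $[0,1]$ is not normal. A sequence $\langle K_i\mid i<\theta\rangle$ of subsets of a space $X$ is discrete iff every point has an open neighborhood meeting at most one $K_i$; $X$ is collectionwise normal iff for every discrete sequence $\langle K_i\mid i<\theta\rangle$ of closed sets there are pairwise disjoint open sets $U_i\supseteq K_i$. $\mathrm{hd}(\mathbb X)$ (hereditary density) is the least infinite cardinal $\nu$ such that every subspace has a dense subset of size $\le\nu$; $\mathrm L(\mathbb X)$ (Lindel\"of degree) is the least infinite cardinal $\nu$ such that every open cover has a subcover of size $\le\nu$. $E^{\lambda^+}_\lambda:=\{\beta<\lambda^+\mid\mathrm{cf}(\beta)=\lambda\}$. A sequence $\langle \mathcal A_\alpha\mid\alpha\in S\rangle$ is an AD-multi-ladder system iff (i) for every nonzero limit $\alpha\in S$, $\mathcal A_\alpha$ is a nonempty family of pairwise disjoint cofinal subsets of $\alpha$, and (ii) for any two distinct $A,A'\in\bigcup_{\alpha\in S}\mathcal A_\alpha$, $\sup(A\cap A')<\sup(A)$. $\clubsuit_{\mathrm{AD}}(\{E^{\lambda^+}_\lambda\},\lambda,1)$ asserts the existence of an AD-multi-ladder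 system $\langle\mathcal A_\alpha\mid\alpha\in E^{\lambda^+}_\lambda\rangle$ with $|\mathcal A_\alpha|=\lambda$ for all $\alpha$, such that for every $B\subseteq\lambda^+$ of size $\lambda^+$ the set $\{\alpha\in E^{\lambda^+}_\lambda\mid\forall A\in\mathcal A_\alpha\ [\sup(A\cap B)=\alpha]\}$ is stationary. *)

theory Defs
  imports "HOL-Analysis.Analysis"
begin

unbundle cardinal_syntax

(* the same symbol in HOL-Library.Set_Algebras makes =o ambiguous *)
no_notation elt_set_eq (infix "=o" 50)

text \<open>
  An ordinal \<open>\<kappa>\<close> is a well-order relation \<open>R\<close>; the ordinals below \<open>\<kappa>\<close> are the elements of
  \<open>Field R\<close>. Following von Neumann, \<open>\<alpha> \<in> Field R\<close> is identified with its initial segment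
  \<open>underS R \<alpha>\<close> and \<open>\<kappa>\<close> with \<open>Field R\<close>, so that suprema are unions, ordinals are compared
  by inclusion, and the supremum of an unbounded subset of \<open>\<kappa>\<close> is \<open>\<kappa>\<close> itself.
\<close>

definition ord_sup :: "'a rel \<Rightarrow> 'a set \<Rightarrow> 'a set" where
  "ord_sup R A = (\<Union>a\<in>A. underS R a)"

definition nonzero_limit :: "'a rel \<Rightarrow> 'a \<Rightarrow> bool" where
  "nonzero_limit R \<alpha> \<longleftrightarrow> \<alpha> \<in> Field R \<and> underS R \<alpha> \<noteq> {} \<and>
     (\<forall>\<beta>\<in>underS R \<alpha>. \<exists>\<gamma>\<in>underS R \<alpha>. \<beta> \<in> underS R \<gamma>)"

text \<open>
  The library's \<^const>\<open>cofinal\<close> asks for strictly larger elements, which is never satisfied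
  below a successor; the following is the usual non-strict notion.
\<close>

definition cofinal_below :: "'a rel \<Rightarrow> 'a \<Rightarrow> 'a set \<Rightarrow> bool" where
  "cofinal_below R \<alpha> A \<longleftrightarrow> A \<subseteq> underS R \<alpha> \<and> (\<forall>\<beta>\<in>underS R \<alpha>. \<exists>\<gamma>\<in>A. (\<beta>, \<gamma>) \<in> R)"

definition has_cofinality :: "'a rel \<Rightarrow> 'a \<Rightarrow> 'b rel \<Rightarrow> bool" where
  "has_cofinality R \<alpha> r \<longleftrightarrow>
     (\<exists>A. cofinal_below R \<alpha> A \<and> |A| =o r) \<and> (\<forall>A. cofinal_below R \<alpha> A \<longrightarrow> r \<le>o |A| )"

definition club_in :: "'a rel \<Rightarrow> 'a set \<Rightarrow> bool" where
  "club_in R C \<longleftrightarrow> C \<subseteq> Field R \<and> ord_sup R C = Field R \<and>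
     (\<forall>\<delta>. nonzero_limit R \<delta> \<and> ord_sup R (C \<inter> underS R \<delta>) = underS R \<delta> \<longrightarrow> \<delta> \<in> C)"

definition stationary_in :: "'a rel \<Rightarrow> 'a set \<Rightarrow> bool" where
  "stationary_in R S \<longleftrightarrow> S \<subseteq> Field R \<and> (\<forall>C. club_in R C \<longrightarrow> S \<inter> C \<noteq> {})"

definition AD_multi_ladder_system :: "'a rel \<Rightarrow> 'a set \<Rightarrow> ('a \<Rightarrow> 'a set set) \<Rightarrow> bool" where
  "AD_multi_ladder_system R S \<A> \<longleftrightarrow>
     (\<forall>\<alpha>\<in>S. nonzero_limit R \<alpha> \<longrightarrow>
        \<A> \<alpha> \<noteq> {} \<and> disjoint (\<A> \<alpha>) \<and> (\<forall>A\<in>\<A> \<alpha>. cofinal_below R \<alpha> A)) \<and>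
     (\<forall>A\<in>(\<Union>\<alpha>\<in>S. \<A> \<alpha>). \<forall>A'\<in>(\<Union>\<alpha>\<in>S. \<A> \<alpha>).
        A \<noteq> A' \<longrightarrow> ord_sup R (A \<inter> A') \<subset> ord_sup R A)"

text \<open>\<open>E\<^sup>\<lambda>\<^sup>+\<^sub>\<lambda>\<close>, with \<open>lam\<close> for \<open>\<lambda>\<close> and \<^term>\<open>cardSuc lam\<close> for \<open>\<lambda>\<^sup>+\<close>.\<close>

definition E_cof :: "'a rel \<Rightarrow> 'a set set" where
  "E_cof lam = {\<beta> \<in> Field (cardSuc lam). has_cofinality (cardSuc lam) \<beta> lam}"

text \<open>\<open>\<clubsuit>\<^sub>A\<^sub>D({E\<^sup>\<lambda>\<^sup>+\<^sub>\<lambda>}, \<lambda>, 1)\<close>\<close>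

definition clubsuit_AD :: "'a rel \<Rightarrow> bool" where
  "clubsuit_AD lam \<longleftrightarrow>
     (\<exists>\<A>. AD_multi_ladder_system (cardSuc lam) (E_cof lam) \<A> \<and>
        (\<forall>\<alpha>\<in>E_cof lam. |\<A> \<alpha>| =o lam) \<and>
        (\<forall>B. B \<subseteq> Field (cardSuc lam) \<and> |B| =o cardSuc lam \<longrightarrow>
           stationary_in (cardSuc lam)
             {\<alpha> \<in> E_cof lam. \<forall>A\<in>\<A> \<alpha>. ord_sup (cardSuc lam) (A \<inter> B) = underS (cardSuc lam) \<alpha>}))"

definition Dowker_space :: "'a topology \<Rightarrow> bool" where
  "Dowker_space X \<longleftrightarrow>
     normal_space X \<and> \<not> normal_space (prod_topology X (top_of_set {0..1::real}))"

definition discrete_family_in :: "'a topology \<Rightarrow> 'i set \<Rightarrow> ('i \<Rightarrow> 'a set) \<Rightarrow> bool" where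
  "discrete_family_in X I K \<longleftrightarrow>
     (\<forall>i\<in>I. K i \<subseteq> topspace X) \<and>
     (\<forall>x\<in>topspace X. \<exists>U. openin X U \<and> x \<in> U \<and>
        (\<forall>i\<in>I. \<forall>j\<in>I. U \<inter> K i \<noteq> {} \<and> U \<inter> K j \<noteq> {} \<longrightarrow> i = j))"

text \<open>
  Index sets are taken in the type of sets of points, since a definition cannot quantify
  over types. Nothing is lost: the nonempty members of a discrete family are pairwise
  distinct, so they can index themselves; see \<open>collectionwise_normal_any_index\<close>.
\<close>

definition collectionwise_normal :: "'a topology \<Rightarrow> bool" where
  "collectionwise_normal X \<longleftrightarrow>
     (\<forall>(I :: 'a set set) K. discrete_family_in X I K \<and> (\<forall>i\<in>I. closedin X (K i)) \<longrightarrow>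
        (\<exists>U. (\<forall>i\<in>I. openin X (U i) \<and> K i \<subseteq> U i) \<and> disjoint_family_on U I))"

lemma collectionwise_normal_any_index:
  fixes I :: "'i set"
  assumes X: "collectionwise_normal X"
    and disc: "discrete_family_in X I K" and cl: "\<And>i. i \<in> I \<Longrightarrow> closedin X (K i)"
  shows "\<exists>U. (\<forall>i\<in>I. openin X (U i) \<and> K i \<subseteq> U i) \<and> disjoint_family_on U I"
proof -
  define J where "J = K ` {i\<in>I. K i \<noteq> {}}"
  have "discrete_family_in X J (\<lambda>A. A)"
    unfolding discrete_family_in_def
  proof (intro conjI ballI)
    fix A assume "A \<in> J"
    then show "A \<subseteq> topspace X" using disc by (auto simp: J_def discrete_family_in_def)
  next
    fix x assume "x \<in> topspace X"
    then obtain U where "openin X U" "x \<in> U"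
      "\<forall>i\<in>I. \<forall>j\<in>I. U \<inter> K i \<noteq> {} \<and> U \<inter> K j \<noteq> {} \<longrightarrow> i = j"
      using disc unfolding discrete_family_in_def by meson
    then show "\<exists>U. openin X U \<and> x \<in> U \<and>
        (\<forall>i\<in>J. \<forall>j\<in>J. U \<inter> i \<noteq> {} \<and> U \<inter> j \<noteq> {} \<longrightarrow> i = j)"
      unfolding J_def by blast
  qed
  moreover have "\<forall>A\<in>J. closedin X A" using cl by (auto simp: J_def)
  ultimately obtain U where U: "\<forall>A\<in>J. openin X (U A) \<and> A \<subseteq> U A" "disjoint_family_on U J"
    using X[unfolded collectionwise_normal_def, rule_format, of J "\<lambda>A. A"] by auto
  have inj: "i = j" if ij: "i \<in> I" "j \<in> I" "K i \<noteq> {}" "K i = K j" for i j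
  proof -
    obtain x where x: "x \<in> K i" using ij by blast
    then have "x \<in> topspace X" using disc ij unfolding discrete_family_in_def by blast
    then obtain V where "x \<in> V" "\<forall>i\<in>I. \<forall>j\<in>I. V \<inter> K i \<noteq> {} \<and> V \<inter> K j \<noteq> {} \<longrightarrow> i = j"
      using disc unfolding discrete_family_in_def by meson
    then show ?thesis using ij x by blast
  qed
  define V where "V i = (if K i = {} then {} else U (K i))" for i
  have "openin X (V i) \<and> K i \<subseteq> V i" if "i \<in> I" for i
    using U(1) that by (auto simp: V_def J_def)
  moreover have "disjoint_family_on V I"
    unfolding disjoint_family_on_def
  proof (intro ballI impI)
    fix i j assume ij: "i \<in> I" "j \<in> I" "i \<noteq> j"
    show "V i \<inter> V j = {}"
    proof (cases "K i = {} \<or> K j = {}")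
      case False
      then have "K i \<in> J" "K j \<in> J" "K i \<noteq> K j" using ij inj by (auto simp: J_def)
      then show ?thesis using False U(2) by (auto simp: V_def disjoint_family_on_def)
    qed (auto simp: V_def)
  qed
  ultimately show ?thesis by blast
qed

text \<open>
  Least infinite cardinals are determined up to \<open>=o\<close>, so \<open>hd(X) = \<nu>\<close> and \<open>L(X) = \<nu>\<close> are
  relations between a space and a cardinal. In the minimality clauses it suffices to let
  \<open>\<mu>\<close> range over the type of \<open>\<nu>\<close>, as every cardinal below \<open>\<nu>\<close> has a copy there; see
  \<open>has_hereditary_density_least\<close> and \<open>has_Lindelof_degree_least\<close>.
\<close>

definition subspaces_density_le :: "'a topology \<Rightarrow> 'b rel \<Rightarrow> bool" where
  "subspaces_density_le X \<nu> \<longleftrightarrow>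
     (\<forall>S. S \<subseteq> topspace X \<longrightarrow> (\<exists>D. D \<subseteq> S \<and> subtopology X S closure_of D = S \<and> |D| \<le>o \<nu>))"

definition has_hereditary_density :: "'a topology \<Rightarrow> 'b rel \<Rightarrow> bool" where
  "has_hereditary_density X \<nu> \<longleftrightarrow> Cinfinite \<nu> \<and> subspaces_density_le X \<nu> \<and>
     (\<forall>\<mu> :: 'b rel. Cinfinite \<mu> \<and> subspaces_density_le X \<mu> \<longrightarrow> \<nu> \<le>o \<mu>)"

definition subcovers_le :: "'a topology \<Rightarrow> 'b rel \<Rightarrow> bool" where
  "subcovers_le X \<nu> \<longleftrightarrow>
     (\<forall>\<U>. (\<forall>U\<in>\<U>. openin X U) \<and> \<Union>\<U> = topspace X \<longrightarrow>
        (\<exists>\<V>. \<V> \<subseteq> \<U> \<and> \<Union>\<V> = topspace X \<and> |\<V>| \<le>o \<nu>))"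

definition has_Lindelof_degree :: "'a topology \<Rightarrow> 'b rel \<Rightarrow> bool" where
  "has_Lindelof_degree X \<nu> \<longleftrightarrow> Cinfinite \<nu> \<and> subcovers_le X \<nu> \<and>
     (\<forall>\<mu> :: 'b rel. Cinfinite \<mu> \<and> subcovers_le X \<mu> \<longrightarrow> \<nu> \<le>o \<mu>)"

lemma Cinfinite_copy_below:
  fixes \<nu> :: "'b rel" and \<mu> :: "'c rel"
  assumes "Cinfinite \<nu>" "Cinfinite \<mu>" "\<not> \<nu> \<le>o \<mu>"
  obtains \<mu>' :: "'b rel" where "Cinfinite \<mu>'" "\<mu> =o \<mu>'"
proof -
  have "\<mu> <o \<nu>"
    using assms not_ordLeq_iff_ordLess[of \<mu> \<nu>]
      card_order_on_well_order_on[of _ \<mu>] card_order_on_well_order_on[of _ \<nu>] by simp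
  then obtain \<mu>' :: "'b rel" where "\<mu> =o \<mu>'"
    using internalize_ordLess[of \<mu> \<nu>] by blast
  then show ?thesis
    using that assms Cinfinite_cong by blast
qed

lemma ordLeq_ordIso_iff: "\<mu> =o \<mu>' \<Longrightarrow> r \<le>o \<mu> \<longleftrightarrow> r \<le>o \<mu>'"
  by (rule iffI, erule ordLeq_ordIso_trans, assumption,
      erule ordLeq_ordIso_trans, erule ordIso_symmetric)

lemma has_hereditary_density_least:
  fixes \<nu> :: "'b rel" and \<mu> :: "'c rel"
  assumes \<nu>: "has_hereditary_density X \<nu>" and \<mu>: "Cinfinite \<mu>" "subspaces_density_le X \<mu>"
  shows "\<nu> \<le>o \<mu>"
proof (rule ccontr)
  assume n: "\<not> \<nu> \<le>o \<mu>"
  then obtain \<mu>' :: "'b rel" where \<mu>': "Cinfinite \<mu>'" "\<mu> =o \<mu>'"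
    using Cinfinite_copy_below[of \<nu> \<mu>] \<nu> \<mu>(1) unfolding has_hereditary_density_def by blast
  have "subspaces_density_le X \<mu>'"
    using \<mu>(2) unfolding subspaces_density_le_def by (simp only: ordLeq_ordIso_iff[OF \<mu>'(2)])
  then have "\<nu> \<le>o \<mu>'" using \<nu> \<mu>' unfolding has_hereditary_density_def by blast
  then have "\<nu> \<le>o \<mu>" by (rule ordLeq_ordIso_trans[OF _ ordIso_symmetric[OF \<mu>'(2)]])
  with n show False ..
qed

lemma has_Lindelof_degree_least:
  fixes \<nu> :: "'b rel" and \<mu> :: "'c rel"
  assumes \<nu>: "has_Lindelof_degree X \<nu>" and \<mu>: "Cinfinite \<mu>" "subcovers_le X \<mu>"
  shows "\<nu> \<le>o \<mu>"
proof (rule ccontr)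
  assume n: "\<not> \<nu> \<le>o \<mu>"
  then obtain \<mu>' :: "'b rel" where \<mu>': "Cinfinite \<mu>'" "\<mu> =o \<mu>'"
    using Cinfinite_copy_below[of \<nu> \<mu>] \<nu> \<mu>(1) unfolding has_Lindelof_degree_def by blast
  have "subcovers_le X \<mu>'"
    using \<mu>(2) unfolding subcovers_le_def by (simp only: ordLeq_ordIso_iff[OF \<mu>'(2)])
  then have "\<nu> \<le>o \<mu>'" using \<nu> \<mu>' unfolding has_Lindelof_degree_def by blast
  then have "\<nu> \<le>o \<mu>" by (rule ordLeq_ordIso_trans[OF _ ordIso_symmetric[OF \<mu>'(2)]])
  with n show False ..
qed

end

theory Submission
  imports Defs
begin

text \<open>
  Points are the ordinals below \<open>\<lambda>\<^sup>+\<close>, split into levels \<open>L\<^sub>n\<close> of size \<open>\<lambda>\<^sup>+\<close>. To every point \<open>\<beta>\<close> and every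
  \<open>\<alpha> < \<beta>\<close> of cofinality \<open>\<lambda>\<close> one attaches a ladder \<open>G \<beta> \<alpha> \<in> \<A>\<^sub>\<alpha>\<close>, and \<open>U\<close> is open iff, for each
  \<open>\<beta> \<in> U\<close> of level \<open>n\<close> and for all but fewer than \<open>\<lambda>\<close> many \<open>\<alpha>\<close>, it contains a tail of the part of
  \<open>G \<beta> \<alpha>\<close> in levels \<open>\<le> n\<close>. By guessing, if \<open>B \<subseteq> L\<^sub>m\<close> has size \<open>\<lambda>\<^sup>+\<close>, then for \<open>\<lambda>\<close> many \<open>\<alpha>\<close> below some
  \<open>\<delta>\<close> all ladders at \<open>\<alpha>\<close> meet \<open>B\<close> cofinally, so every \<open>\<beta> \<ge> \<delta>\<close> of level \<open>\<ge> m\<close> is in the closure of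
  \<open>B \<inter> \<delta>\<close>. This bounds the hereditary density; it shows that an open set containing all levels above
  \<open>n\<close> has a complement of size \<open>\<le> \<lambda>\<close>, whence the Dowker property; and it shows that all but one member of
  a discrete family of closed sets lie below some \<open>\<delta> < \<lambda>\<^sup>+\<close>.

  To separate such a family, truncate the \<open>\<lambda>\<close> many ladders below \<open>\<delta>\<close> so that they become disjoint.
  The ladders \<open>G \<beta> \<alpha>\<close> are chosen by recursion on \<open>\<beta>\<close> so different from each other that each truncated ladder can
  be assigned at most one owner below \<open>\<delta>\<close> such that every \<open>\<gamma> < \<delta>\<close> owns \<open>G \<gamma> \<alpha>\<close>, and no \<open>\<beta> \<ge> \<delta>\<close> uses an owned
  \<open>G \<beta> \<alpha>\<close>, for all but fewer than \<open>\<lambda>\<close> many \<open>\<alpha>\<close>. Points then inherit the colour of the owner of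
  their ladder, and the colour classes are clopen.
\<close>

section \<open>Cardinal arithmetic and greedy choice\<close>

lemma ordLess_Un:
  assumes "Cinfinite r" "|A| <o r" "|B| <o r"
  shows "|A \<union> B| <o r"
  using assms card_of_Un_ordLess_infinite_Field by (metis cinfinite_def)

lemma ordLess_subset: "|B| <o r \<Longrightarrow> A \<subseteq> B \<Longrightarrow> |A| <o r"
  using card_of_mono1 ordLeq_ordLess_trans by blast

lemma ordLeq_subset: "|B| \<le>o r \<Longrightarrow> A \<subseteq> B \<Longrightarrow> |A| \<le>o r"
  using card_of_mono1 ordLeq_transitive by blast

lemma ordLess_singleton:
  assumes "Cinfinite r"
  shows "|{x}| <o r"
  using assms finite_ordLess_infinite[of "|{x}|" r] card_of_Well_order[of "{x}"]
    card_order_on_well_order_on[of "Field r" r]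
  by (simp add: cinfinite_def Field_card_of)

lemma card_of_under_ordLess:
  assumes "Cinfinite r" "b \<in> Field r"
  shows "|under r b| <o r"
proof (rule ordLess_subset)
  show "|underS r b \<union> {b}| <o r"
    using assms card_of_underS by (intro ordLess_Un ordLess_singleton) auto
qed (auto simp: under_def underS_def)

lemma inj_on_vimage_ordLess:
  assumes "inj_on f S" "f ` S \<subseteq> T" "|T| <o r"
  shows "|S| <o r"
proof -
  have "|S| \<le>o |T|" using assms(1,2) card_of_ordLeqI[of f S T] by blast
  then show ?thesis using assms(3) by (rule ordLeq_ordLess_trans)
qed

lemma wf_choice_avoiding:
  fixes r :: "'b rel"
  assumes wf: "wf r" and pred: "\<And>x y. y \<in> pred x \<Longrightarrow> (y, x) \<in> r"
    and less: "\<And>x. |pred x| <o |T|"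
  obtains f where "\<And>x. f x \<in> T" "\<And>x y. y \<in> pred x \<Longrightarrow> f y \<noteq> f x"
proof -
  have "\<exists>f. \<forall>x. f x \<in> T \<and> (\<forall>y\<in>pred x. f y \<noteq> f x)"
  proof (rule dependent_wf_choice[OF wf])
    fix f g :: "'b \<Rightarrow> 'a" and x t
    assume "\<And>z. (z, x) \<in> r \<Longrightarrow> f z = g z"
    then show "(t \<in> T \<and> (\<forall>y\<in>pred x. f y \<noteq> t)) = (t \<in> T \<and> (\<forall>y\<in>pred x. g y \<noteq> t))"
      using pred[of _ x] by metis
  next
    fix x and f :: "'b \<Rightarrow> 'a"
    have "|f ` pred x| <o |T|"
      using less card_of_image ordLeq_ordLess_trans by blast
    then have "\<not> T \<subseteq> f ` pred x"
      using card_of_mono1 not_ordLess_ordLeq by blast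
    then show "\<exists>r. r \<in> T \<and> (\<forall>y\<in>pred x. f y \<noteq> r)" by blast
  qed
  then show thesis using that by blast
qed

section \<open>The ordinals below \<open>\<lambda>\<^sup>+\<close> and sizes relative to
  \<lambda>\<close>

locale regular_order =
  fixes lam :: "'a rel" and R :: "'p rel"
  assumes Cinf: "Cinfinite lam" and reg: "regularCard lam" and wo: "Well_order R"
    and under_ordLeq: "\<And>x. x \<in> Field R \<Longrightarrow> |under R x| \<le>o lam"
    and bounded: "\<And>S. S \<subseteq> Field R \<Longrightarrow> |S| \<le>o lam \<Longrightarrow> \<exists>\<delta>\<in>Field R. S \<subseteq> underS R \<delta>"
begin

text \<open>Sets of size exactly \<lambda> are neither \<open>small\<close> nor \<open>big\<close>.
  They are bounded in \<open>R\<close>, yet no small set of exceptions contains them.\<close>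

abbreviation small :: "'b set \<Rightarrow> bool" where "small S \<equiv> |S| <o lam"
abbreviation big :: "'b set \<Rightarrow> bool" where "big S \<equiv> \<not> |S| \<le>o lam"
abbreviation prec (infix "\<lhd>" 50) where "x \<lhd> y \<equiv> x \<in> underS R y"

lemma Card_order_lam: "Card_order lam"
  using Cinf by blast

lemma prec_Field: "x \<lhd> y \<Longrightarrow> x \<in> Field R" "x \<lhd> y \<Longrightarrow> y \<in> Field R"
  by (auto simp: underS_def Field_def)

lemma prec_irrefl: "\<not> x \<lhd> x"
  by (auto simp: underS_def)

lemma prec_trans: "x \<lhd> y \<Longrightarrow> y \<lhd> z \<Longrightarrow> x \<lhd> z"
  using wo unfolding underS_def well_order_on_def linear_order_on_def partial_order_on_def
    preorder_on_def trans_def antisym_def by blast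

lemma prec_linear: "x \<in> Field R \<Longrightarrow> y \<in> Field R \<Longrightarrow> x \<lhd> y \<or> x = y \<or> y \<lhd> x"
  using wo by (auto simp: underS_def well_order_on_def linear_order_on_def total_on_def)

lemma under_eq: "x \<in> Field R \<Longrightarrow> under R x = insert x (underS R x)"
  using wo by (auto simp: underS_def under_def well_order_on_def linear_order_on_def
      partial_order_on_def preorder_on_def refl_on_def)

lemma wf_prec: "wf {(x, y). x \<lhd> y}"
proof -
  have "{(x, y). x \<lhd> y} = R - Id" by (auto simp: underS_def)
  then show ?thesis using wo by (simp add: well_order_on_def)
qed

lemma underS_ordLeq: "x \<in> Field R \<Longrightarrow> |underS R x| \<le>o lam"
  using under_ordLeq[of x] under_eq[of x] ordLeq_subset by blast

lemma small_UN: "small I \<Longrightarrow> (\<And>i. i \<in> I \<Longrightarrow> small (A i)) \<Longrightarrow> small (\<Union>i\<in>I. A i)"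
  by (rule regularCard_UNION_bound[OF Cinf reg])

lemma small_Un: "small A \<Longrightarrow> small B \<Longrightarrow> small (A \<union> B)"
  by (rule ordLess_Un[OF Cinf])

lemma small_subset: "small B \<Longrightarrow> A \<subseteq> B \<Longrightarrow> small A"
  by (rule ordLess_subset)

lemma small_image: "small A \<Longrightarrow> small (f ` A)"
  using card_of_image ordLeq_ordLess_trans by blast

lemma small_empty: "small {}"
  by (rule small_subset[OF ordLess_singleton[OF Cinf]]) auto

lemma ordLeq_UN: "|I| \<le>o lam \<Longrightarrow> (\<And>i. i \<in> I \<Longrightarrow> |A i| \<le>o lam) \<Longrightarrow> |\<Union>i\<in>I. A i| \<le>o lam"
  using UNION_Cinfinite_bound[OF _ _ Cinf] by blast

lemma countable_ordLeq: "|A::nat set| \<le>o lam"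
  by (rule ordLeq_subset[OF ordIso_ordLeq_trans[OF card_of_nat natLeq_ordLeq_cinfinite[OF Cinf]]])
    simp

lemma ordLeq_Un: "|A| \<le>o lam \<Longrightarrow> |B| \<le>o lam \<Longrightarrow> |A \<union> B| \<le>o lam"
  using card_of_Un_ordLeq_infinite_Field[of lam A B] Cinf by (simp add: cinfinite_def)

lemma big_subset:
  assumes "big S"
  obtains H where "H \<subseteq> S" "|H| =o lam"
proof -
  have "lam \<le>o |S|"
    using assms card_of_Well_order card_order_on_well_order_on[OF Card_order_lam] ordLeq_total
    by blast
  then have "|Field lam| \<le>o |S|"
    using card_of_Field_ordIso[OF Card_order_lam] ordIso_ordLeq_trans by blast
  then obtain H where H: "H \<subseteq> S" "|Field lam| =o |H|"
    using internalize_card_of_ordLeq2[of "Field lam" S] by blast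
  have "|H| =o lam"
    using H(2) card_of_Field_ordIso[OF Card_order_lam] ordIso_symmetric ordIso_transitive by blast
  with H(1) show thesis by (rule that)
qed

end

section \<open>Almost disjoint ladders and guessing\<close>

text \<open>Stationarity enters as size: more than \<lambda> many \<alpha> guess \<open>B\<close>.
  Cofinality \<lambda> enters as boundedness of every small subset of \<alpha>.\<close>

locale guessing_ladders = regular_order lam R
  for lam :: "'a rel" and R :: "'p rel" +
  fixes E :: "'p set" and \<A> :: "'p \<Rightarrow> 'p set set" and lev :: "'p \<Rightarrow> nat"
  assumes E_Field: "E \<subseteq> Field R"
    and E_cofinality: "\<And>\<alpha> S. \<alpha> \<in> E \<Longrightarrow> S \<subseteq> underS R \<alpha> \<Longrightarrow> |S| <o lam \<Longrightarrow>
          \<exists>\<eta>\<in>underS R \<alpha>. S \<subseteq> underS R \<eta>"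
    and card_ladders: "\<And>\<alpha>. \<alpha> \<in> E \<Longrightarrow> |\<A> \<alpha>| =o lam"
    and ladder_subset: "\<And>\<alpha> A. \<alpha> \<in> E \<Longrightarrow> A \<in> \<A> \<alpha> \<Longrightarrow> A \<subseteq> underS R \<alpha>"
    and ladder_unbounded: "\<And>\<alpha> A \<eta>. \<alpha> \<in> E \<Longrightarrow> A \<in> \<A> \<alpha> \<Longrightarrow> \<eta> \<in> underS R \<alpha> \<Longrightarrow> \<not> A \<subseteq> underS R \<eta>"
    and ladders_AD: "\<And>\<alpha> \<alpha>' A A'. \<alpha> \<in> E \<Longrightarrow> \<alpha>' \<in> E \<Longrightarrow> A \<in> \<A> \<alpha> \<Longrightarrow> A' \<in> \<A> \<alpha>' \<Longrightarrow> A \<noteq> A' \<Longrightarrow>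
          \<exists>\<eta>\<in>underS R \<alpha>. A \<inter> A' \<subseteq> underS R \<eta>"
    and guess: "\<And>B. B \<subseteq> Field R \<Longrightarrow> \<not> |B| \<le>o lam \<Longrightarrow>
          \<not> |{\<alpha> \<in> E. \<forall>A\<in>\<A> \<alpha>. \<forall>\<eta>\<in>underS R \<alpha>. \<not> A \<inter> B \<subseteq> underS R \<eta>}| \<le>o lam"
    and levels: "\<And>n. \<not> |{x \<in> Field R. lev x = n}| \<le>o lam"
begin

text \<open>For \<alpha> in \<open>E\<close> these sets form a proper ideal on \<alpha>; a set
  contains a tail of a ladder iff what it misses of the ladder lies in this ideal.\<close>

definition bdd :: "'p \<Rightarrow> 'p set \<Rightarrow> bool" where
  "bdd \<alpha> S \<longleftrightarrow> (\<exists>\<eta>\<in>underS R \<alpha>. S \<subseteq> underS R \<eta>)"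

lemma bdd_mono: "bdd \<alpha> T \<Longrightarrow> S \<subseteq> T \<Longrightarrow> bdd \<alpha> S"
  unfolding bdd_def by blast

text \<open>Fewer than \<lambda> bounds below an \<alpha> of cofinality \<lambda> have a common
  bound below \<alpha>.\<close>

lemma bdd_UN:
  assumes "\<alpha> \<in> E" "small I" "\<And>i. i \<in> I \<Longrightarrow> bdd \<alpha> (S i)"
  shows "bdd \<alpha> (\<Union>i\<in>I. S i)"
proof -
  obtain h where h: "\<And>i. i \<in> I \<Longrightarrow> h i \<lhd> \<alpha> \<and> S i \<subseteq> underS R (h i)"
    using assms(3) unfolding bdd_def by metis
  obtain \<eta> where "\<eta> \<lhd> \<alpha>" "h ` I \<subseteq> underS R \<eta>"
    using E_cofinality[OF assms(1) _ small_image[OF assms(2)], of h] h by blast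
  then show ?thesis using h prec_trans unfolding bdd_def by blast
qed

lemma bdd_Un:
  assumes "\<alpha> \<in> E" "bdd \<alpha> S" "bdd \<alpha> T"
  shows "bdd \<alpha> (S \<union> T)"
proof -
  have "small ({S} \<union> {T})" by (intro small_Un ordLess_singleton Cinf)
  from bdd_UN[OF assms(1) this, of "\<lambda>x. x"] show ?thesis using assms by (auto simp: Un_commute)
qed

lemma bdd_small: "\<alpha> \<in> E \<Longrightarrow> S \<subseteq> underS R \<alpha> \<Longrightarrow> small S \<Longrightarrow> bdd \<alpha> S"
  using E_cofinality unfolding bdd_def by blast

lemma bdd_empty: "\<alpha> \<in> E \<Longrightarrow> bdd \<alpha> {}"
  using bdd_small[OF _ _ small_empty] by simp

lemma bdd_underS: "\<delta> \<lhd> \<alpha> \<Longrightarrow> bdd \<alpha> (underS R \<delta>)"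
  unfolding bdd_def by blast

text \<open>A subset of the smaller ordinal cannot be unbounded in the larger one.\<close>

lemma ladder_top_unique:
  assumes "\<alpha> \<in> E" "\<alpha>' \<in> E" "A \<in> \<A> \<alpha>" "A \<in> \<A> \<alpha>'"
  shows "\<alpha> = \<alpha>'"
proof -
  have "A \<subseteq> underS R \<alpha>" "A \<subseteq> underS R \<alpha>'" using assms ladder_subset by auto
  moreover have "\<alpha> \<in> Field R" "\<alpha>' \<in> Field R" using assms E_Field by auto
  ultimately show ?thesis using ladder_unbounded[of \<alpha> A \<alpha>'] ladder_unbounded[of \<alpha>' A \<alpha>]
    prec_linear assms by blast
qed

lemma big_level:
  assumes "S \<subseteq> Field R" "big S"
  obtains m where "big {x \<in> S. lev x = m}"
proof -
  have "S = (\<Union>m\<in>UNIV. {x \<in> S. lev x = m})" by auto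
  then have "\<not> (\<forall>m. |{x \<in> S. lev x = m}| \<le>o lam)"
    using ordLeq_UN[OF countable_ordLeq[of UNIV], of "\<lambda>m. {x \<in> S. lev x = m}"] assms(2) by auto
  then show thesis using that by blast
qed

text \<open>The at most \<lambda> many ladders below \<delta> are listed in type \<lambda>, and each
  loses its intersections with the earlier ones. These are fewer than \<lambda> many, each bounded
  by almost disjointness, so the loss is bounded.\<close>

lemma disjointify_ladders:
  assumes "\<delta> \<in> Field R"
  obtains tr where
    "\<And>\<alpha> A. \<alpha> \<in> E \<Longrightarrow> \<alpha> \<lhd> \<delta> \<Longrightarrow> A \<in> \<A> \<alpha> \<Longrightarrow> tr A \<subseteq> A \<and> bdd \<alpha> (A - tr A)"
    "\<And>\<alpha> \<alpha>' A A'. \<alpha> \<in> E \<Longrightarrow> \<alpha> \<lhd> \<delta> \<Longrightarrow> A \<in> \<A> \<alpha> \<Longrightarrow> \<alpha>' \<in> E \<Longrightarrow> \<alpha>' \<lhd> \<delta> \<Longrightarrow> A' \<in> \<A> \<alpha>' \<Longrightarrow>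
       A \<noteq> A' \<Longrightarrow> tr A \<inter> tr A' = {}"
proof -
  define F where "F = (\<Union>\<alpha>\<in>E \<inter> underS R \<delta>. \<A> \<alpha>)"
  have "|F| \<le>o lam" unfolding F_def
  proof (rule ordLeq_UN)
    show "|E \<inter> underS R \<delta>| \<le>o lam" using underS_ordLeq[OF assms] ordLeq_subset by blast
  qed (use card_ladders ordIso_iff_ordLeq in blast)
  then have "|F| \<le>o |Field lam|"
    using card_of_Field_ordIso[OF Card_order_lam] ordIso_symmetric ordLeq_ordIso_trans by blast
  then obtain h where h: "inj_on h F" "h ` F \<subseteq> Field lam"
    using card_of_ordLeq[of F "Field lam"] by blast
  define tr where "tr A = A - (\<Union>A'\<in>{A' \<in> F. h A' \<in> underS lam (h A)}. A')" for A
  show thesis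
  proof (rule that)
    fix \<alpha> A assume A: "\<alpha> \<in> E" "\<alpha> \<lhd> \<delta>" "A \<in> \<A> \<alpha>"
    then have AF: "A \<in> F" by (auto simp: F_def)
    let ?I = "{A' \<in> F. h A' \<in> underS lam (h A)}"
    have "small ?I"
    proof (rule inj_on_vimage_ordLess)
      show "inj_on h ?I" using h(1) by (rule inj_on_subset) auto
      show "small (underS lam (h A))"
        using card_of_underS[OF Card_order_lam] h(2) AF by blast
    qed auto
    then have "bdd \<alpha> (\<Union>A'\<in>?I. A \<inter> A')"
    proof (rule bdd_UN[OF A(1)])
      fix A' assume "A' \<in> ?I"
      then have "A' \<noteq> A" "A' \<in> F" by (auto simp: underS_def)
      then show "bdd \<alpha> (A \<inter> A')"
        using ladders_AD A unfolding bdd_def F_def by blast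
    qed
    then show "tr A \<subseteq> A \<and> bdd \<alpha> (A - tr A)"
      by (auto simp: tr_def elim!: bdd_mono)
  next
    fix \<alpha> \<alpha>' A A'
    assume "\<alpha> \<in> E" "\<alpha> \<lhd> \<delta>" "A \<in> \<A> \<alpha>" "\<alpha>' \<in> E" "\<alpha>' \<lhd> \<delta>" "A' \<in> \<A> \<alpha>'" and ne: "A \<noteq> A'"
    then have AF: "A \<in> F" "A' \<in> F" by (auto simp: F_def)
    then have "h A \<noteq> h A'" "h A \<in> Field lam" "h A' \<in> Field lam" using h ne by (auto dest: inj_onD)
    then have "h A \<in> underS lam (h A') \<or> h A' \<in> underS lam (h A)"
      using card_order_on_well_order_on[OF Card_order_lam]
      by (auto simp: underS_def well_order_on_def linear_order_on_def total_on_def)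
    then show "tr A \<inter> tr A' = {}" using AF by (auto simp: tr_def)
  qed
qed

section \<open>Enumerations in type \<lambda> and the choice of ladders\<close>

lemma small_vimage_underS:
  assumes "inj_on f S" "f ` S \<subseteq> Field lam" "b \<in> Field lam"
  shows "small {x \<in> S. f x \<in> underS lam b}"
proof (rule inj_on_vimage_ordLess)
  show "inj_on f {x \<in> S. f x \<in> underS lam b}" using assms(1) by (rule inj_on_subset) auto
  show "small (underS lam b)" using card_of_underS[OF Card_order_lam assms(3)] .
qed auto

text \<open>The values not above \<open>b\<close> form a closed initial segment of \<lambda>, which
  has fewer than \<lambda> elements. With \<open>b\<close> the index of a fixed point, this makes
  almost every \<alpha> come after that point.\<close>

lemma small_not_above:
  assumes "inj_on f S" "f ` S \<subseteq> Field lam" "b \<in> Field lam"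
  shows "small {x \<in> S. b \<notin> underS lam (f x)}"
proof (rule inj_on_vimage_ordLess)
  show "inj_on f {x \<in> S. b \<notin> underS lam (f x)}" using assms(1) by (rule inj_on_subset) auto
  show "f ` {x \<in> S. b \<notin> underS lam (f x)} \<subseteq> under lam b"
    using assms(2,3) card_order_on_well_order_on[OF Card_order_lam]
    by (auto simp: underS_def under_def well_order_on_def linear_order_on_def total_on_def
        partial_order_on_def preorder_on_def refl_on_def image_subset_iff) metis
  show "small (under lam b)" by (rule card_of_under_ordLess[OF Cinf assms(3)])
qed

lemma under_trans: "x \<lhd> y \<Longrightarrow> y \<in> under R z \<Longrightarrow> x \<lhd> z"
  using prec_trans[of x y z] by (cases "y = z") (auto simp: under_def underS_def)

text \<open>
  \<open>e \<beta>\<close> enumerates the ordinals \<open>\<le> \<beta>\<close> in type \<open>\<lambda>\<close>. The last clause asks \<open>G \<beta> \<alpha>\<close> to avoid, for each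
  \<open>\<delta> \<le> \<beta>\<close> enumerated by \<open>\<beta>\<close> before \<open>\<alpha>\<close>, the ladders \<open>G \<gamma> \<alpha>\<close> of all \<open>\<gamma> < \<delta>\<close> enumerated by \<open>\<delta>\<close> before
  \<open>\<alpha>\<close>: fewer than \<open>\<lambda>\<close> many ladders, by regularity.
\<close>

lemma ex_ladder_assignment:
  obtains e :: "'p \<Rightarrow> 'p \<Rightarrow> 'a" and G :: "'p \<Rightarrow> 'p \<Rightarrow> 'p set" where
    "\<And>\<beta>. \<beta> \<in> Field R \<Longrightarrow> inj_on (e \<beta>) (under R \<beta>)"
    "\<And>\<beta>. \<beta> \<in> Field R \<Longrightarrow> e \<beta> ` under R \<beta> \<subseteq> Field lam"
    "\<And>\<alpha> \<beta>. \<alpha> \<in> E \<Longrightarrow> G \<beta> \<alpha> \<in> \<A> \<alpha>"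
    "\<And>\<alpha> \<beta> \<gamma> \<delta>. \<lbrakk>\<alpha> \<in> E; \<alpha> \<lhd> \<gamma>; \<gamma> \<lhd> \<delta>; \<delta> \<in> under R \<beta>; e \<beta> \<delta> \<in> underS lam (e \<beta> \<alpha>);
       e \<delta> \<gamma> \<in> underS lam (e \<delta> \<alpha>)\<rbrakk> \<Longrightarrow> G \<gamma> \<alpha> \<noteq> G \<beta> \<alpha>"
proof -
  have "\<exists>f. inj_on f (under R \<beta>) \<and> f ` under R \<beta> \<subseteq> Field lam" if "\<beta> \<in> Field R" for \<beta>
  proof -
    have "|under R \<beta>| \<le>o |Field lam|"
      using under_ordLeq[OF that] card_of_Field_ordIso[OF Card_order_lam] ordIso_symmetric
        ordLeq_ordIso_trans by blast
    then show ?thesis using card_of_ordLeq[of "under R \<beta>" "Field lam"] by blast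
  qed
  then obtain e :: "'p \<Rightarrow> 'p \<Rightarrow> 'a" where e: "\<And>\<beta>. \<beta> \<in> Field R \<Longrightarrow> inj_on (e \<beta>) (under R \<beta>)"
    "\<And>\<beta>. \<beta> \<in> Field R \<Longrightarrow> e \<beta> ` under R \<beta> \<subseteq> Field lam" by metis
  \<comment> \<open>These are the \<gamma> whose ladder at \<alpha> is forbidden to \<beta>. The two
    nested enumerations make this a union of fewer than \<lambda> small sets.\<close>
  define pred where "pred \<alpha> \<beta> = (\<Union>\<delta>\<in>{\<delta>\<in>under R \<beta>. e \<beta> \<delta> \<in> underS lam (e \<beta> \<alpha>) \<and> \<alpha> \<lhd> \<delta>}.
      {\<gamma>\<in>under R \<delta>. e \<delta> \<gamma> \<in> underS lam (e \<delta> \<alpha>) \<and> \<alpha> \<lhd> \<gamma> \<and> \<gamma> \<lhd> \<delta>})" for \<alpha> \<beta>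
  have small_pred: "small (pred \<alpha> \<beta>)" for \<alpha> \<beta>
  proof (cases "\<alpha> \<lhd> \<beta>")
    case True
    have e_in: "e \<delta> \<alpha> \<in> Field lam" if "\<alpha> \<lhd> \<delta>" for \<delta>
      using that e(2) prec_Field[OF that] underS_subset_under[of R \<delta>] by blast
    show ?thesis unfolding pred_def
    proof (rule small_UN)
      show "small {\<delta>\<in>under R \<beta>. e \<beta> \<delta> \<in> underS lam (e \<beta> \<alpha>) \<and> \<alpha> \<lhd> \<delta>}"
        using prec_Field[OF True]
        by (intro small_subset[OF small_vimage_underS[OF e(1)[of \<beta>] e(2) e_in[OF True]]]) auto
    next
      fix \<delta> assume "\<delta> \<in> {\<delta>\<in>under R \<beta>. e \<beta> \<delta> \<in> underS lam (e \<beta> \<alpha>) \<and> \<alpha> \<lhd> \<delta>}"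
      then have d: "\<alpha> \<lhd> \<delta>" by auto
      show "small {\<gamma>\<in>under R \<delta>. e \<delta> \<gamma> \<in> underS lam (e \<delta> \<alpha>) \<and> \<alpha> \<lhd> \<gamma> \<and> \<gamma> \<lhd> \<delta>}"
        using prec_Field[OF d]
        by (intro small_subset[OF small_vimage_underS[OF e(1)[of \<delta>] e(2) e_in[OF d]]]) auto
    qed
  next
    case False
    then have "pred \<alpha> \<beta> = {}" unfolding pred_def using under_trans by blast
    then show ?thesis using small_empty by simp
  qed
  \<comment> \<open>With \<alpha> fixed, the recursion runs over \<beta>: \<lambda> ladders are
    available at \<alpha> and fewer than \<lambda> are forbidden.\<close>
  have "\<exists>g. \<forall>\<beta>. g \<beta> \<in> \<A> \<alpha> \<and> (\<forall>\<gamma>\<in>pred \<alpha> \<beta>. g \<gamma> \<noteq> g \<beta>)" if "\<alpha> \<in> E" for \<alpha>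
  proof -
    have "|pred \<alpha> \<beta>| <o |\<A> \<alpha>|" for \<beta>
      using small_pred card_ladders[OF that] ordIso_symmetric ordLess_ordIso_trans by blast
    moreover have "(\<gamma>, \<beta>) \<in> {(x, y). x \<lhd> y}" if "\<gamma> \<in> pred \<alpha> \<beta>" for \<beta> \<gamma>
      using that under_trans by (auto simp: pred_def)
    ultimately show ?thesis using wf_choice_avoiding[OF wf_prec, of "pred \<alpha>" "\<A> \<alpha>"] by metis
  qed
  then obtain g where g: "\<And>\<alpha> \<beta>. \<alpha> \<in> E \<Longrightarrow> g \<alpha> \<beta> \<in> \<A> \<alpha>"
    "\<And>\<alpha> \<beta> \<gamma>. \<alpha> \<in> E \<Longrightarrow> \<gamma> \<in> pred \<alpha> \<beta> \<Longrightarrow> g \<alpha> \<gamma> \<noteq> g \<alpha> \<beta>" by metis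
  show thesis
  proof (rule that[of e "\<lambda>\<beta> \<alpha>. g \<alpha> \<beta>"])
    fix \<alpha> \<beta> \<gamma> \<delta>
    assume a: "\<alpha> \<in> E" "\<alpha> \<lhd> \<gamma>" "\<gamma> \<lhd> \<delta>" "\<delta> \<in> under R \<beta>" "e \<beta> \<delta> \<in> underS lam (e \<beta> \<alpha>)"
       "e \<delta> \<gamma> \<in> underS lam (e \<delta> \<alpha>)"
    then have "\<gamma> \<in> pred \<alpha> \<beta>"
      using prec_trans underS_subset_under[of R \<delta>] unfolding pred_def by blast
    then show "g \<alpha> \<gamma> \<noteq> g \<alpha> \<beta>" using g a by blast
  qed (use e g in auto)
qed

end

section \<open>The ladder topology\<close>

locale ladder_space = guessing_ladders lam R E \<A> lev
  for lam :: "'a rel" and R :: "'p rel" and E \<A> lev +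
  fixes e :: "'p \<Rightarrow> 'p \<Rightarrow> 'a" and G :: "'p \<Rightarrow> 'p \<Rightarrow> 'p set"
  assumes e_inj: "\<And>\<beta>. \<beta> \<in> Field R \<Longrightarrow> inj_on (e \<beta>) (under R \<beta>)"
    and e_Field: "\<And>\<beta>. \<beta> \<in> Field R \<Longrightarrow> e \<beta> ` under R \<beta> \<subseteq> Field lam"
    and G_in: "\<And>\<alpha> \<beta>. \<alpha> \<in> E \<Longrightarrow> G \<beta> \<alpha> \<in> \<A> \<alpha>"
    and G_avoid: "\<And>\<alpha> \<beta> \<gamma> \<delta>. \<lbrakk>\<alpha> \<in> E; \<alpha> \<lhd> \<gamma>; \<gamma> \<lhd> \<delta>; \<delta> \<in> under R \<beta>; e \<beta> \<delta> \<in> underS lam (e \<beta> \<alpha>);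
       e \<delta> \<gamma> \<in> underS lam (e \<delta> \<alpha>)\<rbrakk> \<Longrightarrow> G \<gamma> \<alpha> \<noteq> G \<beta> \<alpha>"

lemma (in guessing_ladders) ex_ladder_space:
  "\<exists>e G. ladder_space lam R E \<A> lev e G"
  by (rule ex_ladder_assignment) (intro exI, unfold_locales, blast+)

context ladder_space
begin

text \<open>Discarding levels above that of \<beta> makes every set of points of level at most
  \<open>n\<close> open.\<close>

definition lad :: "'p \<Rightarrow> 'p \<Rightarrow> 'p set" where
  "lad \<beta> \<alpha> = {x \<in> G \<beta> \<alpha>. lev x \<le> lev \<beta>}"

text \<open>If fewer than \<lambda> members of \<open>E\<close> lie below \<beta>, everything holds
  mostly, so such a \<beta> is an isolated point of the space.\<close>

definition mostly :: "'p \<Rightarrow> ('p \<Rightarrow> bool) \<Rightarrow> bool" where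
  "mostly \<beta> P \<longleftrightarrow> small {\<alpha> \<in> E. \<alpha> \<lhd> \<beta> \<and> \<not> P \<alpha>}"

lemma mostly_mono:
  assumes "mostly \<beta> P" "\<And>\<alpha>. \<alpha> \<in> E \<Longrightarrow> \<alpha> \<lhd> \<beta> \<Longrightarrow> P \<alpha> \<Longrightarrow> Q \<alpha>"
  shows "mostly \<beta> Q"
  using assms unfolding mostly_def by (elim small_subset) auto

lemma mostly_conj:
  assumes "mostly \<beta> P" "mostly \<beta> Q"
  shows "mostly \<beta> (\<lambda>\<alpha>. P \<alpha> \<and> Q \<alpha>)"
  using small_Un[OF assms[unfolded mostly_def]] unfolding mostly_def by (elim small_subset) auto

lemma mostly_all: "(\<And>\<alpha>. \<alpha> \<in> E \<Longrightarrow> \<alpha> \<lhd> \<beta> \<Longrightarrow> P \<alpha>) \<Longrightarrow> mostly \<beta> P"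
  using small_subset[OF small_empty, of "{\<alpha> \<in> E. \<alpha> \<lhd> \<beta> \<and> \<not> P \<alpha>}"] unfolding mostly_def by blast

definition X :: "'p topology" where
  "X = topology (\<lambda>U. U \<subseteq> Field R \<and> (\<forall>\<beta>\<in>U. mostly \<beta> (\<lambda>\<alpha>. bdd \<alpha> (lad \<beta> \<alpha> - U))))"

text \<open>Exceptional \<alpha> and bounded sets both form ideals, which gives closure under
  intersection; enlarging \<open>U\<close> only shrinks \<open>lad \<beta> \<alpha> - U\<close>,
  which gives closure under unions.\<close>

lemma openin_X:
  "openin X U \<longleftrightarrow> U \<subseteq> Field R \<and> (\<forall>\<beta>\<in>U. mostly \<beta> (\<lambda>\<alpha>. bdd \<alpha> (lad \<beta> \<alpha> - U)))"
proof -
  have "istopology (\<lambda>U. U \<subseteq> Field R \<and> (\<forall>\<beta>\<in>U. mostly \<beta> (\<lambda>\<alpha>. bdd \<alpha> (lad \<beta> \<alpha> - U))))"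
    unfolding istopology_def
  proof (intro conjI allI impI ballI)
    fix S T \<beta>
    assume "S \<subseteq> Field R \<and> (\<forall>\<beta>\<in>S. mostly \<beta> (\<lambda>\<alpha>. bdd \<alpha> (lad \<beta> \<alpha> - S)))"
      and "T \<subseteq> Field R \<and> (\<forall>\<beta>\<in>T. mostly \<beta> (\<lambda>\<alpha>. bdd \<alpha> (lad \<beta> \<alpha> - T)))" and "\<beta> \<in> S \<inter> T"
    then have "mostly \<beta> (\<lambda>\<alpha>. bdd \<alpha> (lad \<beta> \<alpha> - S) \<and> bdd \<alpha> (lad \<beta> \<alpha> - T))"
      by (intro mostly_conj) auto
    then show "mostly \<beta> (\<lambda>\<alpha>. bdd \<alpha> (lad \<beta> \<alpha> - (S \<inter> T)))"
      by (rule mostly_mono) (metis bdd_Un Diff_Int)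
  next
    fix \<K> \<beta>
    assume K: "\<forall>K\<in>\<K>. K \<subseteq> Field R \<and> (\<forall>\<beta>\<in>K. mostly \<beta> (\<lambda>\<alpha>. bdd \<alpha> (lad \<beta> \<alpha> - K)))" and "\<beta> \<in> \<Union>\<K>"
    then obtain K where "K \<in> \<K>" "mostly \<beta> (\<lambda>\<alpha>. bdd \<alpha> (lad \<beta> \<alpha> - K))" by blast
    then show "mostly \<beta> (\<lambda>\<alpha>. bdd \<alpha> (lad \<beta> \<alpha> - \<Union>\<K>))"
      by (elim mostly_mono) (auto elim: bdd_mono)
  qed auto
  then show ?thesis unfolding X_def by (simp add: topology_inverse')
qed

lemma lad_subset: "\<alpha> \<in> E \<Longrightarrow> lad \<beta> \<alpha> \<subseteq> underS R \<alpha>"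
  using ladder_subset G_in unfolding lad_def by blast

lemma topspace_X: "topspace X = Field R"
proof
  have "bdd \<alpha> (lad \<beta> \<alpha> - Field R)" if "\<alpha> \<in> E" for \<alpha> \<beta>
    using lad_subset[OF that] prec_Field(1) by (intro bdd_mono[OF bdd_empty[OF that]]) blast
  then have "openin X (Field R)" unfolding openin_X by (auto intro: mostly_all)
  then show "Field R \<subseteq> topspace X" by (rule openin_subset)
  show "topspace X \<subseteq> Field R" using openin_topspace[of X] unfolding openin_X by blast
qed

lemma closedin_X:
  "closedin X C \<longleftrightarrow> C \<subseteq> Field R \<and> (\<forall>\<beta>\<in>Field R - C. mostly \<beta> (\<lambda>\<alpha>. bdd \<alpha> (lad \<beta> \<alpha> \<inter> C)))"
proof -
  have eq: "lad \<beta> \<alpha> - (Field R - C) = lad \<beta> \<alpha> \<inter> C" if "\<alpha> \<in> E" for \<alpha> \<beta>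
    using lad_subset[OF that] prec_Field(1) by blast
  show ?thesis
    unfolding closedin_def topspace_X openin_X mostly_def
    by (simp add: eq cong: conj_cong)
qed

text \<open>Ladders attached to a \<beta> below \<delta> lie below \<beta>. These segments form the
  cover that has no subcover of size \<lambda>.\<close>

lemma openin_underS: "openin X (underS R \<delta>)"
  unfolding openin_X
proof (intro conjI ballI mostly_all)
  fix \<beta> \<alpha> assume "\<beta> \<lhd> \<delta>" "\<alpha> \<in> E" "\<alpha> \<lhd> \<beta>"
  then have "lad \<beta> \<alpha> - underS R \<delta> = {}" using lad_subset prec_trans by blast
  then show "bdd \<alpha> (lad \<beta> \<alpha> - underS R \<delta>)" using \<open>\<alpha> \<in> E\<close> bdd_empty by metis
qed (use prec_Field in blast)

text \<open>By cofinality \<lambda>, fewer than \<lambda> points meet each ladder in a bounded set.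
  This gives both T1 and the lower bound on hereditary density.\<close>

lemma closedin_small:
  assumes "C \<subseteq> Field R" "small C"
  shows "closedin X C"
  unfolding closedin_X
proof (intro conjI ballI mostly_all)
  fix \<beta> \<alpha> assume "\<alpha> \<in> E"
  then show "bdd \<alpha> (lad \<beta> \<alpha> \<inter> C)"
    using bdd_small[of \<alpha> "lad \<beta> \<alpha> \<inter> C"] lad_subset[of \<alpha> \<beta>] small_subset[OF assms(2)] by blast
qed (use assms in auto)

lemma t1_space_X: "t1_space X"
  unfolding t1_space_closedin_singleton topspace_X
  by (auto intro!: closedin_small ordLess_singleton Cinf)

lemma openin_lev_le: "openin X {x \<in> Field R. lev x \<le> n}"
  unfolding openin_X
proof (intro conjI ballI mostly_all)
  fix \<beta> \<alpha> assume "\<beta> \<in> {x \<in> Field R. lev x \<le> n}" "\<alpha> \<in> E"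
  then have "lad \<beta> \<alpha> - {x \<in> Field R. lev x \<le> n} = {}"
    using lad_subset[of \<alpha> \<beta>] prec_Field(1) unfolding lad_def by fastforce
  then show "bdd \<alpha> (lad \<beta> \<alpha> - {x \<in> Field R. lev x \<le> n})" using \<open>\<alpha> \<in> E\<close> bdd_empty by metis
qed auto

text \<open>Choose \<delta> above a set \<open>H\<close> of \<lambda> many guessing \<alpha>. Some
  \<alpha> in \<open>H\<close> is not exceptional for \<beta>; its ladder meets \<open>B\<close>
  cofinally, inside \<open>lad\<close> because \<open>m \<le> lev \<beta>\<close>, and
  \<open>U\<close> contains a tail of it.\<close>

lemma big_accumulates:
  assumes B: "B \<subseteq> Field R" "big B" and m: "\<And>x. x \<in> B \<Longrightarrow> lev x = m"
  obtains \<delta> where "\<delta> \<in> Field R"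
    "\<And>U \<beta>. openin X U \<Longrightarrow> \<beta> \<in> U \<Longrightarrow> \<not> \<beta> \<lhd> \<delta> \<Longrightarrow> m \<le> lev \<beta> \<Longrightarrow> U \<inter> B \<inter> underS R \<delta> \<noteq> {}"
proof -
  define S where "S = {\<alpha> \<in> E. \<forall>A\<in>\<A> \<alpha>. \<not> bdd \<alpha> (A \<inter> B)}"
  have "big S" using guess[OF B] unfolding S_def bdd_def by simp
  then obtain H where H: "H \<subseteq> S" and Hlam: "|H| =o lam" by (rule big_subset)
  obtain \<delta> where \<delta>: "\<delta> \<in> Field R" "H \<subseteq> underS R \<delta>"
    using bounded[of H] H E_Field ordIso_imp_ordLeq[OF Hlam] unfolding S_def by blast
  show thesis
  proof (rule that[OF \<delta>(1)])
    fix U \<beta> assume U: "openin X U" "\<beta> \<in> U" "\<not> \<beta> \<lhd> \<delta>" "m \<le> lev \<beta>"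
    then have "mostly \<beta> (\<lambda>\<alpha>. bdd \<alpha> (lad \<beta> \<alpha> - U))" "\<beta> \<in> Field R" unfolding openin_X by auto
    moreover have "\<not> small H" using Hlam not_ordLess_ordIso by blast
    ultimately obtain \<alpha> where \<alpha>: "\<alpha> \<in> H" "\<not> (\<alpha> \<in> E \<and> \<alpha> \<lhd> \<beta> \<and> \<not> bdd \<alpha> (lad \<beta> \<alpha> - U))"
      unfolding mostly_def using small_subset by blast
    have E: "\<alpha> \<in> E" "\<alpha> \<lhd> \<delta>" "\<And>A. A \<in> \<A> \<alpha> \<Longrightarrow> \<not> bdd \<alpha> (A \<inter> B)"
      using \<alpha>(1) H \<delta>(2) unfolding S_def by auto
    have "\<alpha> \<lhd> \<beta>" using E(2) U(3) prec_linear[OF \<delta>(1) \<open>\<beta> \<in> Field R\<close>] prec_trans by blast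
    then have "bdd \<alpha> (lad \<beta> \<alpha> - U)" using \<alpha> E by blast
    moreover have "\<not> bdd \<alpha> (G \<beta> \<alpha> \<inter> B)" using E G_in by blast
    ultimately have "\<not> G \<beta> \<alpha> \<inter> B \<subseteq> lad \<beta> \<alpha> - U" using bdd_mono by blast
    moreover have "G \<beta> \<alpha> \<inter> B \<subseteq> lad \<beta> \<alpha>" using m U(4) unfolding lad_def by auto
    ultimately obtain x where "x \<in> lad \<beta> \<alpha>" "x \<in> B" "x \<in> U" by blast
    then show "U \<inter> B \<inter> underS R \<delta> \<noteq> {}" using lad_subset[OF E(1)] E(2) prec_trans by blast
  qed
qed

end

section \<open>Discrete families, colourings and normality of products\<close>

text \<open>A suitable neighbourhood of a point outside the union meets at most one member, and that
  closed member can be removed from it.\<close>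

lemma discrete_family_Union_closedin:
  assumes disc: "discrete_family_in X I K" and cl: "\<And>i. i \<in> I \<Longrightarrow> closedin X (K i)"
    and J: "J \<subseteq> I"
  shows "closedin X (\<Union>i\<in>J. K i)"
  unfolding closedin_def
proof
  show "(\<Union>i\<in>J. K i) \<subseteq> topspace X" using disc J unfolding discrete_family_in_def by blast
  show "openin X (topspace X - (\<Union>i\<in>J. K i))"
  proof (subst openin_subopen, intro ballI)
    fix x assume x: "x \<in> topspace X - (\<Union>i\<in>J. K i)"
    then obtain U where U: "openin X U" "x \<in> U"
      "\<forall>i\<in>I. \<forall>j\<in>I. U \<inter> K i \<noteq> {} \<and> U \<inter> K j \<noteq> {} \<longrightarrow> i = j"
      using disc unfolding discrete_family_in_def by (metis DiffD1)
    show "\<exists>T. openin X T \<and> x \<in> T \<and> T \<subseteq> topspace X - (\<Union>i\<in>J. K i)"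
    proof (cases "\<exists>i\<in>J. U \<inter> K i \<noteq> {}")
      case True
      then obtain i where i: "i \<in> J" "U \<inter> K i \<noteq> {}" by blast
      then have "U \<inter> K j = {}" if "j \<in> J" "j \<noteq> i" for j using U(3) J that by blast
      then have "U - K i \<subseteq> topspace X - (\<Union>i\<in>J. K i)" using openin_subset[OF U(1)] by blast
      moreover have "openin X (U - K i)" using U(1) cl i J by blast
      ultimately show ?thesis using U(2) x i by blast
    next
      case False
      then have "U \<subseteq> topspace X - (\<Union>i\<in>J. K i)" using openin_subset[OF U(1)] by blast
      then show ?thesis using U by blast
    qed
  qed
qed

lemma discrete_family_disjoint:
  assumes "discrete_family_in X I K" "i \<in> I" "j \<in> I" "x \<in> K i" "x \<in> K j"
  shows "i = j"
proof -
  have "x \<in> topspace X" using assms unfolding discrete_family_in_def by blast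
  then obtain U where "x \<in> U" "\<forall>i\<in>I. \<forall>j\<in>I. U \<inter> K i \<noteq> {} \<and> U \<inter> K j \<noteq> {} \<longrightarrow> i = j"
    using assms(1) unfolding discrete_family_in_def by meson
  then show ?thesis using assms by blast
qed

text \<open>\<open>par\<close> sends a point of a truncated ladder to the owner of that ladder. Chains along \<open>par\<close> may be infinite;
  their points stay uncoloured.\<close>

inductive colour :: "('p \<Rightarrow> 'p \<Rightarrow> bool) \<Rightarrow> 'i set \<Rightarrow> ('i \<Rightarrow> 'p set) \<Rightarrow> 'p \<Rightarrow> 'i \<Rightarrow> bool"
  for par I K where
  base: "i \<in> I \<Longrightarrow> x \<in> K i \<Longrightarrow> colour par I K x i"
| step: "x \<notin> (\<Union>i\<in>I. K i) \<Longrightarrow> par x y \<Longrightarrow> colour par I K y i \<Longrightarrow> colour par I K x i"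

text \<open>Membership in the family decides which rule applies, and \<open>par\<close> is
  functional, so the chain leading from a coloured point into the family is determined.\<close>

lemma colour_unique:
  assumes "colour par I K x i" "colour par I K x j"
    and par: "\<And>x y z. par x y \<Longrightarrow> par x z \<Longrightarrow> y = z"
    and disj: "\<And>i j x. i \<in> I \<Longrightarrow> j \<in> I \<Longrightarrow> x \<in> K i \<Longrightarrow> x \<in> K j \<Longrightarrow> i = j"
  shows "i = j"
  using assms(1,2)
proof (induction arbitrary: j)
  case (base i x)
  then show ?case using disj by (auto elim: colour.cases)
next
  case (step x y i)
  from step.prems show ?case
  proof cases
    case base
    then show ?thesis using step.hyps by blast
  next
    case (step y')
    then show ?thesis using step.IH par[OF step.hyps(2)] by blast
  qed
qed

text \<open>One half of Dowker's criterion. Separate the bottom edge from the complement of an open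
  region \<open>W\<close>; \<open>V n\<close> is the slice at height \<open>a n\<close> of the open
  set around that complement. A point in all slices would have its bottom point in the closure of
  \<open>Q\<close>, yet in the disjoint open set \<open>P\<close>.\<close>

lemma normal_product_imp_open_expansion:
  assumes norm: "normal_space (prod_topology X (top_of_set {0..1::real}))"
    and F: "\<And>n. closedin X (F n)" "\<And>n. F (Suc n) \<subseteq> F n" "(\<Inter>n. F n) = {}"
  obtains V where "\<And>n::nat. openin X (V n)" "\<And>n. F n \<subseteq> V n" "(\<Inter>n. V n) = {}"
proof -
  define Y where "Y = prod_topology X (top_of_set {0..1::real})"
  define a :: "nat \<Rightarrow> real" where "a n = 1 / real (n + 1)" for n
  have a01: "a n \<in> {0..1}" "0 < a n" for n by (auto simp: a_def)
  have decF: "F n \<subseteq> F m" if "m \<le> n" for m n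
    using lift_Suc_antimono_le[of F m n] F(2) that by blast
  \<comment> \<open>The region under a staircase: over \<open>x\<close> it reaches up to
    \<open>a n\<close> for the first \<open>n\<close> with \<open>x\<close> outside
    \<open>F n\<close>.\<close>
  define W where "W = (\<Union>n. (topspace X - F n) \<times> ({..<a n} \<inter> {0..1}))"
  have "openin (top_of_set {0..1}) ({..<a n} \<inter> {0..1::real})" for n
    by (auto simp: openin_open Int_commute intro!: exI[of _ "{..<a n}"])
  then have W: "openin Y W"
    unfolding Y_def W_def using F(1)
    by (intro openin_Union) (auto simp: openin_prod_Times_iff closedin_def)
  have "closedin Y (topspace X \<times> {0})"
    unfolding Y_def by (auto simp: closedin_prod_Times_iff)
  moreover have "closedin Y (topspace Y - W)" using W by blast
  \<comment> \<open>Every \<open>x\<close> leaves some \<open>F n\<close> and \<open>a n\<close> is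
    positive, so the bottom edge lies in \<open>W\<close>.\<close>
  moreover have "disjnt (topspace X \<times> {0}) (topspace Y - W)"
    using F(3) a01 by (fastforce simp: disjnt_def W_def)
  ultimately obtain P Q where PQ: "openin Y P" "openin Y Q" "topspace X \<times> {0} \<subseteq> P"
    "topspace Y - W \<subseteq> Q" "disjnt P Q"
    using norm unfolding normal_space_def Y_def[symmetric] by meson
  define V where "V n = {x \<in> topspace X. (x, a n) \<in> Q}" for n
  show thesis
  proof
    fix n
    have "continuous_map X Y (\<lambda>x. (x, a n))"
      unfolding Y_def using a01(1)[of n] by (intro continuous_map_pairedI) auto
    from openin_continuous_map_preimage[OF this PQ(2)] show "openin X (V n)"
      unfolding V_def .
    show "F n \<subseteq> V n"
    proof
      fix x assume x: "x \<in> F n"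
      then have xX: "x \<in> topspace X" using closedin_subset[OF F(1)] by blast
      have "(x, a n) \<notin> W"
      proof
        assume "(x, a n) \<in> W"
        then obtain m where m: "x \<notin> F m" "a n < a m" unfolding W_def by blast
        then have "m < n" by (auto simp: a_def field_simps)
        then show False using decF[of m n] m x by auto
      qed
      then show "x \<in> V n" using PQ(4) xX a01(1)[of n] unfolding V_def Y_def by auto
    qed
  next
    show "(\<Inter>n. V n) = {}"
    proof (rule ccontr)
      assume "(\<Inter>n. V n) \<noteq> {}"
      then obtain x where x: "\<And>n. x \<in> V n" by blast
      then have "(x, 0) \<in> P" using PQ(3) unfolding V_def by blast
      then obtain S T where ST: "openin X S" "openin (top_of_set {0..1}) T" "x \<in> S" "0 \<in> T" "S \<times> T \<subseteq> P"
        using PQ(1) unfolding Y_def openin_prod_topology_alt by meson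
      obtain O' where O': "open O'" "T = {0..1} \<inter> O'" using ST(2) unfolding openin_open by blast
      have "a \<longlonglongrightarrow> 0" unfolding a_def using LIMSEQ_inverse_real_of_nat
        by (simp add: inverse_eq_divide add.commute)
      then have "eventually (\<lambda>n. a n \<in> O') sequentially"
        using O' ST(4) topological_tendstoD[of a 0 sequentially O'] by blast
      then obtain n where "a n \<in> O'" using eventually_happens by force
      then have "(x, a n) \<in> P" using ST O' a01 by blast
      then show False using x[of n] PQ(5) unfolding V_def disjnt_def by blast
    qed
  qed
qed

text \<open>Two disjoint closed sets form a discrete family indexed by the booleans: each point
  misses one of them, and the complement of that one is the neighbourhood.\<close>

lemma collectionwise_normal_imp_normal_space:
  assumes "collectionwise_normal X"
  shows "normal_space X"
  unfolding normal_space_def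
proof (intro allI impI)
  fix S T assume ST: "closedin X S \<and> closedin X T \<and> disjnt S T"
  show "\<exists>U V. openin X U \<and> openin X V \<and> S \<subseteq> U \<and> T \<subseteq> V \<and> disjnt U V"
  proof -
    define K where "K b = (if b then S else T)" for b
    have "discrete_family_in X (UNIV::bool set) K"
      unfolding discrete_family_in_def
    proof (intro conjI ballI)
      fix i :: bool show "K i \<subseteq> topspace X" using ST closedin_subset unfolding K_def by auto
    next
      fix x assume x: "x \<in> topspace X"
      show "\<exists>U. openin X U \<and> x \<in> U \<and>
          (\<forall>i\<in>UNIV. \<forall>j\<in>UNIV. U \<inter> K i \<noteq> {} \<and> U \<inter> K j \<noteq> {} \<longrightarrow> i = j)"
      proof (cases "x \<in> S")
        case True
        then show ?thesis using ST x
          by (intro exI[of _ "topspace X - T"]) (auto simp: K_def disjnt_def split: if_splits)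
      next
        case False
        then show ?thesis using ST x
          by (intro exI[of _ "topspace X - S"]) (auto simp: K_def disjnt_def split: if_splits)
      qed
    qed
    moreover have "closedin X (K b)" for b using ST unfolding K_def by auto
    ultimately obtain U where U: "\<And>i. openin X (U i) \<and> K i \<subseteq> U i" "disjoint_family_on U UNIV"
      using collectionwise_normal_any_index[OF assms, of UNIV K] by auto
    have "openin X (U True)" "openin X (U False)" "S \<subseteq> U True" "T \<subseteq> U False"
      using U(1)[of True] U(1)[of False] unfolding K_def by auto
    moreover have "disjnt (U True) (U False)"
      using U(2)[unfolded disjoint_family_on_def, rule_format, of True False] by (simp add: disjnt_def)
    ultimately show ?thesis by blast
  qed
qed

section \<open>Big closed sets and the size of discrete families\<close>

context ladder_space
begin

text \<open>Otherwise the open complement of \<open>C\<close> would contain a point at which the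
  level \<open>m\<close> part of \<open>C\<close> accumulates.\<close>

lemma closedin_big:
  assumes C: "closedin X C" "big {x \<in> C. lev x = m}"
  obtains \<delta> where "\<delta> \<in> Field R" "\<And>\<beta>. \<beta> \<in> Field R \<Longrightarrow> \<not> \<beta> \<lhd> \<delta> \<Longrightarrow> m \<le> lev \<beta> \<Longrightarrow> \<beta> \<in> C"
proof -
  have CR: "C \<subseteq> Field R" using closedin_subset[OF C(1)] topspace_X by simp
  have op: "openin X (Field R - C)" using C(1) unfolding closedin_def topspace_X by blast
  show thesis
  proof (rule big_accumulates[OF _ C(2), of m])
    fix \<delta> assume \<delta>: "\<delta> \<in> Field R"
      "\<And>U \<beta>. openin X U \<Longrightarrow> \<beta> \<in> U \<Longrightarrow> \<not> \<beta> \<lhd> \<delta> \<Longrightarrow> m \<le> lev \<beta> \<Longrightarrow>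
        U \<inter> {x \<in> C. lev x = m} \<inter> underS R \<delta> \<noteq> {}"
    show thesis
    proof (rule that[OF \<delta>(1)])
      fix \<beta> assume "\<beta> \<in> Field R" "\<not> \<beta> \<lhd> \<delta>" "m \<le> lev \<beta>"
      then show "\<beta> \<in> C" using \<delta>(2)[OF op, of \<beta>] by blast
    qed
  qed (use CR in auto)
qed

lemma ex_level_above:
  assumes "|S| \<le>o lam"
  obtains \<beta> where "\<beta> \<in> Field R" "lev \<beta> = n" "\<beta> \<notin> S"
  using levels[of n] ordLeq_subset[OF assms, of "{x \<in> Field R. lev x = n}"] by blast

text \<open>Two big closed sets share every point that lies far enough out and on a high enough
  level.\<close>

lemma closedin_disjoint_not_big:
  assumes "closedin X C" "closedin X D" "C \<inter> D = {}"
  shows "|C| \<le>o lam \<or> |D| \<le>o lam"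
proof (rule ccontr)
  assume big: "\<not> ( |C| \<le>o lam \<or> |D| \<le>o lam)"
  have CD: "C \<subseteq> Field R" "D \<subseteq> Field R"
    using closedin_subset[OF assms(1)] closedin_subset[OF assms(2)] topspace_X by auto
  obtain m where m: "big {x \<in> C. lev x = m}" using big by (auto intro: big_level[OF CD(1)])
  obtain n where n: "big {x \<in> D. lev x = n}" using big by (auto intro: big_level[OF CD(2)])
  obtain c where c: "c \<in> Field R" "\<And>\<beta>. \<beta> \<in> Field R \<Longrightarrow> \<not> \<beta> \<lhd> c \<Longrightarrow> m \<le> lev \<beta> \<Longrightarrow> \<beta> \<in> C"
    using closedin_big[OF assms(1) m] by blast
  obtain d where d: "d \<in> Field R" "\<And>\<beta>. \<beta> \<in> Field R \<Longrightarrow> \<not> \<beta> \<lhd> d \<Longrightarrow> n \<le> lev \<beta> \<Longrightarrow> \<beta> \<in> D"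
    using closedin_big[OF assms(2) n] by blast
  obtain \<beta> where "\<beta> \<in> Field R" "lev \<beta> = max m n" "\<beta> \<notin> underS R c \<union> underS R d"
    using ex_level_above[OF ordLeq_Un[OF underS_ordLeq[OF c(1)] underS_ordLeq[OF d(1)]]] by blast
  then have "\<beta> \<in> C \<inter> D" using c(2) d(2) by simp
  then show False using assms(3) by blast
qed

text \<open>One level of a big \<open>P\<close> would accumulate, already from below \<delta>, at
  its own points beyond \<delta>, although its part below \<delta> is closed.\<close>

lemma discrete_closedin_not_big:
  assumes P: "P \<subseteq> Field R" and cl: "\<And>S. S \<subseteq> P \<Longrightarrow> closedin X S"
  shows "|P| \<le>o lam"
proof (rule ccontr)
  assume "big P"
  then obtain m where m: "big {x \<in> P. lev x = m}" using big_level[OF P] by blast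
  let ?Q = "{x \<in> P. lev x = m}"
  show False
  proof (rule big_accumulates[OF _ m, of m])
    fix \<delta> assume \<delta>: "\<delta> \<in> Field R"
      "\<And>U \<beta>. openin X U \<Longrightarrow> \<beta> \<in> U \<Longrightarrow> \<not> \<beta> \<lhd> \<delta> \<Longrightarrow> m \<le> lev \<beta> \<Longrightarrow> U \<inter> ?Q \<inter> underS R \<delta> \<noteq> {}"
    obtain \<beta> where \<beta>: "\<beta> \<in> ?Q" "\<not> \<beta> \<lhd> \<delta>"
      using m ordLeq_subset[OF underS_ordLeq[OF \<delta>(1)], of ?Q] by blast
    have "closedin X (?Q \<inter> underS R \<delta>)" by (rule cl) auto
    then have "openin X (Field R - ?Q \<inter> underS R \<delta>)" unfolding closedin_def topspace_X by blast
    from \<delta>(2)[OF this, of \<beta>] show False using \<beta> P by auto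
  qed (use P in auto)
qed

text \<open>If a member is big, the union of the others is closed and disjoint from it. If none is,
  points chosen from the nonempty members form a closed discrete set, so at most \<lambda> members
  are nonempty and any \<open>i0\<close> will do.\<close>

lemma discrete_family_all_but_one_not_big:
  assumes disc: "discrete_family_in X I K" and cl: "\<And>i. i \<in> I \<Longrightarrow> closedin X (K i)" and "I \<noteq> {}"
  obtains i0 where "i0 \<in> I" "|\<Union>i\<in>I - {i0}. K i| \<le>o lam"
proof (cases "\<exists>i\<in>I. big (K i)")
  case True
  then obtain i where i: "i \<in> I" "big (K i)" by blast
  have "closedin X (\<Union>j\<in>I - {i}. K j)"
    by (rule discrete_family_Union_closedin[OF disc cl]) auto
  moreover have "K i \<inter> (\<Union>j\<in>I - {i}. K j) = {}"
    using discrete_family_disjoint[OF disc] i by blast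
  ultimately show thesis using closedin_disjoint_not_big[OF cl[OF i(1)]] i that by blast
next
  case False
  define I' where "I' = {i \<in> I. K i \<noteq> {}}"
  have "\<forall>i\<in>I'. \<exists>x. x \<in> K i" unfolding I'_def by blast
  from bchoice[OF this] obtain p where p: "\<And>i. i \<in> I' \<Longrightarrow> p i \<in> K i" by blast
  have pX: "p i \<in> Field R" if "i \<in> I'" for i
    using p[OF that] that disc unfolding discrete_family_in_def topspace_X I'_def by blast
  have disc': "discrete_family_in X I' (\<lambda>i. {p i})"
    unfolding discrete_family_in_def topspace_X
  proof (intro conjI ballI)
    fix x assume "x \<in> Field R"
    then obtain U where U: "openin X U" "x \<in> U"
      "\<forall>i\<in>I. \<forall>j\<in>I. U \<inter> K i \<noteq> {} \<and> U \<inter> K j \<noteq> {} \<longrightarrow> i = j"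
      using disc unfolding discrete_family_in_def topspace_X by meson
    have "i = j" if "i \<in> I'" "j \<in> I'" "p i \<in> U" "p j \<in> U" for i j
    proof -
      have "i \<in> I" "j \<in> I" using that unfolding I'_def by auto
      then show ?thesis using U(3) p[OF that(1)] p[OF that(2)] that by blast
    qed
    then show "\<exists>U. openin X U \<and> x \<in> U \<and>
        (\<forall>i\<in>I'. \<forall>j\<in>I'. U \<inter> {p i} \<noteq> {} \<and> U \<inter> {p j} \<noteq> {} \<longrightarrow> i = j)"
      using U by (intro exI[of _ U]) auto
  qed (use pX in auto)
  have "inj_on p I'"
  proof (rule inj_onI)
    fix i j assume "i \<in> I'" "j \<in> I'" "p i = p j"
    then show "i = j" using discrete_family_disjoint[OF disc', of i j "p i"] by auto
  qed
  have "|p ` I'| \<le>o lam"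
  proof (rule discrete_closedin_not_big)
    fix S assume "S \<subseteq> p ` I'"
    then obtain J where J: "J \<subseteq> I'" "S = p ` J" by (meson subset_image_iff)
    have "closedin X (\<Union>i\<in>J. {p i})"
      by (rule discrete_family_Union_closedin[OF disc' _ J(1)])
        (use pX in \<open>auto intro!: closedin_small ordLess_singleton Cinf\<close>)
    then show "closedin X S" unfolding J(2) by (simp add: UNION_singleton_eq_range)
  qed (use pX in auto)
  moreover have "|I'| \<le>o |p ` I'|" using \<open>inj_on p I'\<close> card_of_ordLeqI by blast
  ultimately have "|I'| \<le>o lam" using ordLeq_transitive by blast
  then have "|\<Union>i\<in>I'. K i| \<le>o lam" using False by (intro ordLeq_UN) (auto simp: I'_def)
  moreover obtain i0 where "i0 \<in> I" using assms(3) by blast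
  moreover have "(\<Union>i\<in>I - {i0}. K i) \<subseteq> (\<Union>i\<in>I'. K i)" unfolding I'_def by blast
  ultimately show thesis using that ordLeq_subset by blast
qed

section \<open>Ownership of ladders and collectionwise normality\<close>

text \<open>The owner is the point first enumerated by \<open>e \<delta>\<close> among those between
  \<alpha> and \<delta> that use \<open>A\<close> at \<alpha>. It must also precede \<alpha>, so
  that \<open>G_avoid\<close> keeps later points off \<open>A\<close>.\<close>

definition owner :: "'p \<Rightarrow> 'p \<Rightarrow> 'p set \<Rightarrow> 'p \<Rightarrow> bool" where
  "owner \<delta> \<alpha> A y \<longleftrightarrow> \<alpha> \<lhd> y \<and> y \<lhd> \<delta> \<and> e \<delta> y \<in> underS lam (e \<delta> \<alpha>) \<and> G y \<alpha> = A \<and>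
     (\<forall>z. \<alpha> \<lhd> z \<longrightarrow> z \<lhd> \<delta> \<longrightarrow> e \<delta> z \<in> underS lam (e \<delta> y) \<longrightarrow> G z \<alpha> \<noteq> A)"

lemma e_in_Field: "x \<in> under R \<beta> \<Longrightarrow> e \<beta> x \<in> Field lam"
  using e_Field[of \<beta>] by (force simp: under_def Field_def)

lemma underS_lam_linear:
  assumes "a \<in> Field lam" "b \<in> Field lam"
  shows "a \<in> underS lam b \<or> a = b \<or> b \<in> underS lam a"
  using assms card_order_on_well_order_on[OF Card_order_lam]
  by (auto simp: underS_def well_order_on_def linear_order_on_def total_on_def)

lemma prec_under: "x \<lhd> y \<Longrightarrow> x \<in> under R y"
  by (simp add: underS_def under_def)

lemma under_refl: "x \<in> Field R \<Longrightarrow> x \<in> under R x"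
  by (simp add: under_eq)

lemma owner_unique:
  assumes "owner \<delta> \<alpha> A y" "owner \<delta> \<alpha> A z"
  shows "y = z"
proof -
  have "y \<lhd> \<delta>" "z \<lhd> \<delta>" using assms unfolding owner_def by auto
  then have u: "y \<in> under R \<delta>" "z \<in> under R \<delta>" "\<delta> \<in> Field R" using prec_under prec_Field by auto
  then have "e \<delta> y = e \<delta> z"
    using underS_lam_linear[OF e_in_Field e_in_Field] assms unfolding owner_def by blast
  then show ?thesis using inj_onD[OF e_inj] u by blast
qed

text \<open>Use \<open>G_avoid\<close> with both \<delta> and \<beta> equal to the larger point; it
  applies once \<alpha> is enumerated after both points.\<close>

lemma small_G_eq:
  assumes "y \<in> Field R" "z \<in> Field R" "y \<noteq> z"
  shows "small {\<alpha> \<in> E. \<alpha> \<lhd> y \<and> \<alpha> \<lhd> z \<and> G y \<alpha> = G z \<alpha>}"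
proof -
  have *: "small {\<alpha> \<in> E. \<alpha> \<lhd> y \<and> \<alpha> \<lhd> z \<and> G y \<alpha> = G z \<alpha>}" if yz: "y \<lhd> z" for y z
  proof -
    have z: "z \<in> Field R" using prec_Field yz by blast
    have "small ({\<alpha> \<in> under R z. e z z \<notin> underS lam (e z \<alpha>)} \<union>
        {\<alpha> \<in> under R z. e z y \<notin> underS lam (e z \<alpha>)})"
      using z yz by (intro small_Un small_not_above e_inj e_Field e_in_Field prec_under under_refl)
    moreover have "{\<alpha> \<in> E. \<alpha> \<lhd> y \<and> \<alpha> \<lhd> z \<and> G y \<alpha> = G z \<alpha>} \<subseteq>
        {\<alpha> \<in> under R z. e z z \<notin> underS lam (e z \<alpha>)} \<union> {\<alpha> \<in> under R z. e z y \<notin> underS lam (e z \<alpha>)}"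
      using G_avoid[of _ y z z] yz under_refl[OF z] prec_under by blast
    ultimately show ?thesis by (rule small_subset)
  qed
  from prec_linear[OF assms(1,2)] show ?thesis
  proof (elim disjE)
    assume "z \<lhd> y"
    from *[OF this] show ?thesis by (rule small_subset) auto
  qed (use * assms in auto)
qed

text \<open>Ownership fails only if \<alpha> is not enumerated after \<open>y\<close>, or if one of
  the fewer than \<lambda> points enumerated before \<open>y\<close> shares its ladder; each such
  point does so at fewer than \<lambda> many \<alpha>.\<close>

lemma mostly_owner:
  assumes y: "y \<lhd> \<delta>"
  shows "mostly y (\<lambda>\<alpha>. owner \<delta> \<alpha> (G y \<alpha>) y)"
proof -
  have \<delta>: "\<delta> \<in> Field R" using prec_Field y by blast
  let ?S = "{\<alpha> \<in> under R \<delta>. e \<delta> y \<notin> underS lam (e \<delta> \<alpha>)}"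
  let ?Z = "{z \<in> under R \<delta>. e \<delta> z \<in> underS lam (e \<delta> y)}"
  let ?T = "\<Union>z\<in>?Z. {\<alpha> \<in> E. \<alpha> \<lhd> z \<and> \<alpha> \<lhd> y \<and> G z \<alpha> = G y \<alpha>}"
  have "small ?T"
  proof (rule small_UN)
    show "small ?Z" using y \<delta> by (intro small_vimage_underS e_inj e_Field e_in_Field prec_under)
    fix z assume z: "z \<in> ?Z"
    then have "z \<noteq> y" "z \<in> Field R" by (auto simp: underS_def under_def Field_def)
    then show "small {\<alpha> \<in> E. \<alpha> \<lhd> z \<and> \<alpha> \<lhd> y \<and> G z \<alpha> = G y \<alpha>}"
      using small_G_eq prec_Field(1)[OF y] by blast
  qed
  moreover have "small ?S"
    using y \<delta> by (intro small_not_above e_inj e_Field e_in_Field prec_under)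
  ultimately have "small (?S \<union> ?T)" by (rule small_Un[rotated])
  then show ?thesis unfolding mostly_def
  proof (rule small_subset)
    show "{\<alpha> \<in> E. \<alpha> \<lhd> y \<and> \<not> owner \<delta> \<alpha> (G y \<alpha>) y} \<subseteq> ?S \<union> ?T"
    proof
      fix \<alpha> assume \<alpha>: "\<alpha> \<in> {\<alpha> \<in> E. \<alpha> \<lhd> y \<and> \<not> owner \<delta> \<alpha> (G y \<alpha>) y}"
      then have "\<alpha> \<in> under R \<delta>" using prec_trans[OF _ y] prec_under by blast
      with \<alpha> y show "\<alpha> \<in> ?S \<union> ?T" unfolding owner_def using prec_under by blast
    qed
  qed
qed

text \<open>\<open>G_avoid\<close> forbids an owned ladder to \<beta> whenever
  \<open>e \<beta>\<close> lists \<delta> before \<alpha>.\<close>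

lemma mostly_no_owner:
  assumes "\<delta> \<in> under R \<beta>"
  shows "mostly \<beta> (\<lambda>\<alpha>. \<forall>y. \<not> owner \<delta> \<alpha> (G \<beta> \<alpha>) y)"
proof -
  have \<beta>: "\<beta> \<in> Field R" using assms by (auto simp: under_def Field_def)
  have "small {\<alpha> \<in> under R \<beta>. e \<beta> \<delta> \<notin> underS lam (e \<beta> \<alpha>)}"
    using assms \<beta> by (intro small_not_above e_inj e_Field e_in_Field)
  then show ?thesis unfolding mostly_def
    by (rule small_subset) (use G_avoid assms prec_under in \<open>unfold owner_def, blast\<close>)
qed

text \<open>Along almost every ladder of a point, a tail either is owned by that point and inherits
  its colour, or has no owner and stays uncoloured outside the family.\<close>

lemma separate_below:
  assumes disc: "discrete_family_in X I K" and cl: "\<And>i. i \<in> I \<Longrightarrow> closedin X (K i)"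
    and i0: "i0 \<in> I" and \<delta>: "\<delta> \<in> Field R" and below: "(\<Union>i\<in>I - {i0}. K i) \<subseteq> underS R \<delta>"
  obtains U where "\<And>i. i \<in> I \<Longrightarrow> openin X (U i)" "\<And>i. i \<in> I \<Longrightarrow> K i \<subseteq> U i" "disjoint_family_on U I"
proof (rule disjointify_ladders[OF \<delta>])
  fix tr assume tr:
    "\<And>\<alpha> A. \<alpha> \<in> E \<Longrightarrow> \<alpha> \<lhd> \<delta> \<Longrightarrow> A \<in> \<A> \<alpha> \<Longrightarrow> tr A \<subseteq> A \<and> bdd \<alpha> (A - tr A)"
    "\<And>\<alpha> \<alpha>' A A'. \<alpha> \<in> E \<Longrightarrow> \<alpha> \<lhd> \<delta> \<Longrightarrow> A \<in> \<A> \<alpha> \<Longrightarrow> \<alpha>' \<in> E \<Longrightarrow> \<alpha>' \<lhd> \<delta> \<Longrightarrow> A' \<in> \<A> \<alpha>' \<Longrightarrow>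
       A \<noteq> A' \<Longrightarrow> tr A \<inter> tr A' = {}"
  define par where "par x y \<longleftrightarrow>
    (\<exists>\<alpha>\<in>E. \<exists>A\<in>\<A> \<alpha>. \<alpha> \<lhd> \<delta> \<and> x \<in> tr A \<and> owner \<delta> \<alpha> A y)" for x y
  \<comment> \<open>Truncated ladders are disjoint and a ladder determines its \<alpha>, so
    \<open>x\<close> has only one possible pair of \<alpha> and \<open>A\<close>.\<close>
  have par_eq: "owner \<delta> \<alpha> A y" if "\<alpha> \<in> E" "A \<in> \<A> \<alpha>" "\<alpha> \<lhd> \<delta>" "x \<in> tr A" and p: "par x y" for \<alpha> A x y
  proof -
    obtain \<alpha>' A' where A': "\<alpha>' \<in> E" "A' \<in> \<A> \<alpha>'" "\<alpha>' \<lhd> \<delta>" "x \<in> tr A'" "owner \<delta> \<alpha>' A' y"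
      using p unfolding par_def by blast
    have "A' = A" using tr(2)[OF that(1,3,2) A'(1,3,2)] that(4) A'(4) by blast
    moreover have "\<alpha>' = \<alpha>" using ladder_top_unique[OF A'(1) that(1)] A'(2) that(2) \<open>A' = A\<close> by blast
    ultimately show ?thesis using A'(5) by simp
  qed
  have par_unique: "y = z" if p: "par x y" "par x z" for x y z
  proof -
    obtain \<alpha> A where A: "\<alpha> \<in> E" "A \<in> \<A> \<alpha>" "\<alpha> \<lhd> \<delta>" "x \<in> tr A" "owner \<delta> \<alpha> A y"
      using p(1) unfolding par_def by blast
    show ?thesis using owner_unique[OF A(5) par_eq[OF A(1-4) p(2)]] .
  qed
  have K_disj: "i = j" if "i \<in> I" "j \<in> I" "x \<in> K i" "x \<in> K j" for i j x
    using discrete_family_disjoint[OF disc that] .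
  have K_Field: "K i \<subseteq> Field R" if "i \<in> I" for i
    using disc that unfolding discrete_family_in_def topspace_X by blast
  let ?col = "colour par I K"
  have col_unique: "i = j" if "?col x i" "?col x j" for x i j
    by (rule colour_unique[OF that par_unique K_disj])
  have col_below: "x \<lhd> \<delta>" if "?col x i" "i \<noteq> i0" for x i
    using that
  proof cases
    case base
    then show ?thesis using below that by blast
  next
    case (step y)
    then obtain \<alpha> A where "\<alpha> \<in> E" "A \<in> \<A> \<alpha>" "\<alpha> \<lhd> \<delta>" "x \<in> tr A" unfolding par_def by blast
    then show ?thesis using tr(1) ladder_subset prec_trans by blast
  qed
  have closed_mostly: "mostly \<beta> (\<lambda>\<alpha>. bdd \<alpha> (lad \<beta> \<alpha> \<inter> (\<Union>j\<in>J. K j)))"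
    if "\<beta> \<in> Field R" "J \<subseteq> I" "\<beta> \<notin> (\<Union>j\<in>J. K j)" for \<beta> J
    using discrete_family_Union_closedin[OF disc cl that(2)] that(1,3) unfolding closedin_X by blast
  have bdd_tr: "bdd \<alpha> (lad \<beta> \<alpha> - tr (G \<beta> \<alpha>))" if "\<alpha> \<in> E" "\<alpha> \<lhd> \<delta>" for \<alpha> \<beta>
    by (rule bdd_mono[OF conjunct2[OF tr(1)[OF that G_in[OF that(1)]]]]) (auto simp: lad_def)
  \<comment> \<open>Uncoloured points go to \<open>i0\<close>; all other classes lie below
    \<delta>.\<close>
  define U where "U i = (if i = i0 then Field R - {x. \<exists>j. j \<noteq> i0 \<and> ?col x j} else {x. ?col x i})" for i
  have "openin X (U i)" if i: "i \<in> I" "i \<noteq> i0" for i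
    unfolding openin_X
  proof (intro conjI ballI)
    show "U i \<subseteq> Field R" using i col_below prec_Field(1) unfolding U_def by auto
    fix \<gamma> assume "\<gamma> \<in> U i"
    then have col: "?col \<gamma> i" using i unfolding U_def by simp
    then have \<gamma>: "\<gamma> \<lhd> \<delta>" using col_below i by blast
    \<comment> \<open>A tail avoids only the members not containing \<gamma>. A ladder point in a
      member that contains \<gamma> already has the colour of \<gamma>.\<close>
    have "mostly \<gamma> (\<lambda>\<alpha>. bdd \<alpha> (lad \<gamma> \<alpha> \<inter> (\<Union>j\<in>{j \<in> I. \<gamma> \<notin> K j}. K j)))"
      by (rule closed_mostly) (use prec_Field(1)[OF \<gamma>] in auto)
    from mostly_conj[OF this mostly_owner[OF \<gamma>]]
    show "mostly \<gamma> (\<lambda>\<alpha>. bdd \<alpha> (lad \<gamma> \<alpha> - U i))"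
    proof (rule mostly_mono)
      fix \<alpha> assume \<alpha>: "\<alpha> \<in> E" "\<alpha> \<lhd> \<gamma>" and
        a: "bdd \<alpha> (lad \<gamma> \<alpha> \<inter> (\<Union>j\<in>{j \<in> I. \<gamma> \<notin> K j}. K j)) \<and> owner \<delta> \<alpha> (G \<gamma> \<alpha>) \<gamma>"
      have \<alpha>\<delta>: "\<alpha> \<lhd> \<delta>" using \<alpha> \<gamma> prec_trans by blast
      have "bdd \<alpha> ((lad \<gamma> \<alpha> \<inter> (\<Union>j\<in>{j \<in> I. \<gamma> \<notin> K j}. K j)) \<union> (lad \<gamma> \<alpha> - tr (G \<gamma> \<alpha>)))"
        by (rule bdd_Un[OF \<alpha>(1) conjunct1[OF a] bdd_tr[OF \<alpha>(1) \<alpha>\<delta>]])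
      moreover have "lad \<gamma> \<alpha> - U i \<subseteq>
          (lad \<gamma> \<alpha> \<inter> (\<Union>j\<in>{j \<in> I. \<gamma> \<notin> K j}. K j)) \<union> (lad \<gamma> \<alpha> - tr (G \<gamma> \<alpha>))"
      proof
        fix x assume x: "x \<in> lad \<gamma> \<alpha> - U i"
        show "x \<in> (lad \<gamma> \<alpha> \<inter> (\<Union>j\<in>{j \<in> I. \<gamma> \<notin> K j}. K j)) \<union> (lad \<gamma> \<alpha> - tr (G \<gamma> \<alpha>))"
        proof (rule ccontr)
          assume n: "\<not> ?thesis"
          then have xt: "x \<in> tr (G \<gamma> \<alpha>)" using x by blast
          have "?col x i"
          proof (cases "x \<in> (\<Union>j\<in>I. K j)")
            case True
            then obtain j where j: "j \<in> I" "x \<in> K j" by blast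
            then have "\<gamma> \<in> K j" using n x by blast
            then have "?col \<gamma> j" by (rule colour.base[OF j(1)])
            then have "j = i" using col by (rule col_unique)
            moreover have "?col x j" using j by (rule colour.base)
            ultimately show ?thesis by simp
          next
            case False
            have "par x \<gamma>" unfolding par_def using \<alpha> G_in \<alpha>\<delta> xt a by blast
            with False show ?thesis using col by (rule colour.step)
          qed
          then show False using x i unfolding U_def by simp
        qed
      qed
      ultimately show "bdd \<alpha> (lad \<gamma> \<alpha> - U i)" by (rule bdd_mono)
    qed
  qed
  moreover have "openin X (U i0)"
    unfolding openin_X
  proof (intro conjI ballI)
    show "U i0 \<subseteq> Field R" unfolding U_def by simp
    fix \<beta> assume "\<beta> \<in> U i0"
    then have \<beta>: "\<beta> \<in> Field R" and ncol: "\<And>j. j \<noteq> i0 \<Longrightarrow> \<not> ?col \<beta> j" unfolding U_def by auto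
    let ?M = "\<Union>j\<in>I - {i0}. K j"
    have "\<beta> \<notin> K j" if "j \<in> I - {i0}" for j
      using ncol[of j] that by (auto intro: colour.base)
    then have M: "mostly \<beta> (\<lambda>\<alpha>. bdd \<alpha> (lad \<beta> \<alpha> \<inter> ?M))"
      by (intro closed_mostly[OF \<beta>]) auto
    \<comment> \<open>Below \<delta> a point mostly owns its ladders itself; from \<delta> on its
      ladders mostly have no owner.\<close>
    have own: "mostly \<beta> (\<lambda>\<alpha>. \<forall>y. owner \<delta> \<alpha> (G \<beta> \<alpha>) y \<longrightarrow> y = \<beta>)"
    proof (cases "\<beta> \<lhd> \<delta>")
      case True
      show ?thesis by (rule mostly_mono[OF mostly_owner[OF True]]) (use owner_unique in blast)
    next
      case False
      then have "\<delta> \<in> under R \<beta>" using prec_linear[OF \<beta> \<delta>] prec_under under_refl \<delta> by blast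
      then show ?thesis by (rule mostly_mono[OF mostly_no_owner]) blast
    qed
    \<comment> \<open>Ladders at \<open>\<delta>\<close> itself lie below \<open>\<delta>\<close> but have not been truncated.\<close>
    have "mostly \<beta> (\<lambda>\<alpha>. \<alpha> \<noteq> \<delta>)"
      unfolding mostly_def by (rule small_subset[OF ordLess_singleton[OF Cinf, of \<delta>]]) auto
    from mostly_conj[OF this mostly_conj[OF M own]]
    show "mostly \<beta> (\<lambda>\<alpha>. bdd \<alpha> (lad \<beta> \<alpha> - U i0))"
    proof (rule mostly_mono)
      fix \<alpha> assume \<alpha>: "\<alpha> \<in> E" "\<alpha> \<lhd> \<beta>" and
        a: "\<alpha> \<noteq> \<delta> \<and> bdd \<alpha> (lad \<beta> \<alpha> \<inter> ?M) \<and> (\<forall>y. owner \<delta> \<alpha> (G \<beta> \<alpha>) y \<longrightarrow> y = \<beta>)"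
      have "lad \<beta> \<alpha> \<subseteq> Field R" using lad_subset[OF \<alpha>(1)] prec_Field(1) by blast
      then have lad_U: "\<exists>j. j \<noteq> i0 \<and> ?col x j" if "x \<in> lad \<beta> \<alpha> - U i0" for x
        using that unfolding U_def by auto
      show "bdd \<alpha> (lad \<beta> \<alpha> - U i0)"
      proof (cases "\<alpha> \<lhd> \<delta>")
        case True
        have "lad \<beta> \<alpha> - U i0 \<subseteq> (lad \<beta> \<alpha> \<inter> ?M) \<union> (lad \<beta> \<alpha> - tr (G \<beta> \<alpha>))"
        proof
          fix x assume x: "x \<in> lad \<beta> \<alpha> - U i0"
          then obtain j where j: "j \<noteq> i0" "?col x j" using lad_U by blast
          show "x \<in> (lad \<beta> \<alpha> \<inter> ?M) \<union> (lad \<beta> \<alpha> - tr (G \<beta> \<alpha>))"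
          proof (rule ccontr)
            assume n: "\<not> ?thesis"
            from j(2) show False
            proof cases
              case base
              then show ?thesis using n x j(1) by blast
            next
              case (step y)
              \<comment> \<open>The parent of \<open>x\<close> owns the ladder of \<beta>, so it can
                only be \<beta>, which has no colour other than \<open>i0\<close>.\<close>
              have "y = \<beta>" using par_eq[OF \<alpha>(1) G_in[OF \<alpha>(1)] True _ step(2)] n x a by blast
              then show ?thesis using step ncol j(1) by blast
            qed
          qed
        qed
        then show ?thesis
          by (rule bdd_mono[OF bdd_Un[OF \<alpha>(1) conjunct1[OF conjunct2[OF a]] bdd_tr[OF \<alpha>(1) True]]])
      next
        case False
        \<comment> \<open>Points of a colour other than \<open>i0\<close> lie below \<delta>, which
          is itself a bound below \<alpha>.\<close>
        then have "\<delta> \<lhd> \<alpha>" using a prec_linear[OF _ \<delta>] \<alpha> E_Field by blast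
        moreover have "lad \<beta> \<alpha> - U i0 \<subseteq> underS R \<delta>" using lad_U col_below by blast
        ultimately show ?thesis by (rule bdd_mono[OF bdd_underS])
      qed
    qed
  qed
  ultimately have "openin X (U i)" if "i \<in> I" for i using that by (cases "i = i0") auto
  moreover have "K i \<subseteq> U i" if i: "i \<in> I" for i
  proof
    fix x assume x: "x \<in> K i"
    have col: "?col x i" using i x by (rule colour.base)
    have "\<not> (\<exists>j. j \<noteq> i0 \<and> ?col x j)" if "i = i0"
      using col_unique[OF col] that by blast
    moreover have "x \<in> Field R" using K_Field[OF i] x by blast
    ultimately show "x \<in> U i" using col unfolding U_def by (cases "i = i0") simp_all
  qed
  moreover have "disjoint_family_on U I"
    unfolding disjoint_family_on_def
  proof (intro ballI impI equals0I)
    fix i j x assume "i \<in> I" "j \<in> I" "i \<noteq> j" and x: "x \<in> U i \<inter> U j"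
    show False
    proof (cases "i = i0 \<or> j = i0")
      case True
      then show ?thesis using x \<open>i \<noteq> j\<close> unfolding U_def by (auto split: if_splits)
    next
      case False
      then have "?col x i" "?col x j" using x unfolding U_def by auto
      then show ?thesis using col_unique \<open>i \<noteq> j\<close> by blast
    qed
  qed
  ultimately show thesis by (rule that)
qed

lemma collectionwise_normal_X: "collectionwise_normal X"
  unfolding collectionwise_normal_def
proof (intro allI impI)
  fix I :: "'p set set" and K
  assume a: "discrete_family_in X I K \<and> (\<forall>i\<in>I. closedin X (K i))"
  show "\<exists>U. (\<forall>i\<in>I. openin X (U i) \<and> K i \<subseteq> U i) \<and> disjoint_family_on U I"
  proof (cases "I = {}")
    case False
    have disc: "discrete_family_in X I K" and cl: "\<And>i. i \<in> I \<Longrightarrow> closedin X (K i)" using a by auto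
    obtain i0 where i0: "i0 \<in> I" "|\<Union>i\<in>I - {i0}. K i| \<le>o lam"
      by (rule discrete_family_all_but_one_not_big[OF disc cl False])
    have "(\<Union>i\<in>I - {i0}. K i) \<subseteq> Field R"
      using disc unfolding discrete_family_in_def topspace_X by blast
    from bounded[OF this i0(2)] obtain \<delta> where \<delta>: "\<delta> \<in> Field R" "(\<Union>i\<in>I - {i0}. K i) \<subseteq> underS R \<delta>"
      by blast
    show ?thesis
    proof (rule separate_below[OF disc cl i0(1) \<delta>])
      fix U assume "\<And>i. i \<in> I \<Longrightarrow> openin X (U i)" "\<And>i. i \<in> I \<Longrightarrow> K i \<subseteq> U i" "disjoint_family_on U I"
      then show ?thesis by blast
    qed
  qed (auto simp: disjoint_family_on_def)
qed

lemma Hausdorff_space_X: "Hausdorff_space X"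
  using collectionwise_normal_X collectionwise_normal_imp_normal_space normal_t1_imp_Hausdorff_space
    t1_space_X by blast

section \<open>Dowker property, hereditary density and Lindelof degree\<close>

lemma big_Field: "big (Field R)"
  using levels[of 0] ordLeq_subset[of "Field R" lam "{x \<in> Field R. lev x = 0}"] by blast

text \<open>The sets of points of level above \<open>n\<close> are closed and decrease to the empty
  set. Any open expansion omits at most \<lambda> points at each stage, hence cannot have empty
  intersection.\<close>

lemma Dowker_space_X: "Dowker_space X"
  unfolding Dowker_space_def
proof
  show "normal_space X"
    by (rule collectionwise_normal_imp_normal_space[OF collectionwise_normal_X])
  show "\<not> normal_space (prod_topology X (top_of_set {0..1::real}))"
  proof
    assume norm: "normal_space (prod_topology X (top_of_set {0..1::real}))"
    define F where "F n = {x \<in> Field R. n < lev x}" for n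
    have F: "Field R - F n = {x \<in> Field R. lev x \<le> n}" for n by (auto simp: F_def)
    have "closedin X (F n)" for n
      unfolding closedin_def topspace_X F using openin_lev_le by (auto simp: F_def)
    moreover have "F (Suc n) \<subseteq> F n" for n by (auto simp: F_def)
    moreover have "(\<Inter>n. F n) = {}" by (auto simp: F_def)
    ultimately obtain V where V: "\<And>n::nat. openin X (V n)" "\<And>n. F n \<subseteq> V n" "(\<Inter>n. V n) = {}"
      using normal_product_imp_open_expansion[OF norm, of F] by blast
    have "|Field R - V n| \<le>o lam" for n
    proof (rule ccontr)
      assume big: "big (Field R - V n)"
      have cl: "closedin X (Field R - V n)"
        using V(1)[of n] openin_closedin_eq topspace_X by metis
      obtain m where m: "big {x \<in> Field R - V n. lev x = m}"
        using big by (auto intro: big_level[of "Field R - V n"])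
      show False
      proof (rule closedin_big[OF cl m])
        fix \<delta> assume \<delta>: "\<delta> \<in> Field R"
          "\<And>\<beta>. \<beta> \<in> Field R \<Longrightarrow> \<not> \<beta> \<lhd> \<delta> \<Longrightarrow> m \<le> lev \<beta> \<Longrightarrow> \<beta> \<in> Field R - V n"
        \<comment> \<open>The level is at least \<open>m\<close>, putting \<beta> in the complement
          of \<open>V n\<close>, and exceeds \<open>n\<close>, putting it in
          \<open>F n\<close>.\<close>
        obtain \<beta> where "\<beta> \<in> Field R" "lev \<beta> = max m (Suc n)" "\<beta> \<notin> underS R \<delta>"
          by (rule ex_level_above[OF underS_ordLeq[OF \<delta>(1)]])
        then show False using \<delta>(2)[of \<beta>] V(2)[of n] unfolding F_def by auto
      qed
    qed
    then have "|\<Union>n. Field R - V n| \<le>o lam"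
      by (intro ordLeq_UN countable_ordLeq)
    moreover have "(\<Union>n. Field R - V n) = Field R" using V(3) by auto
    ultimately show False using big_Field by simp
  qed
qed

text \<open>Level by level: a level of \<open>S\<close> of size at most \<lambda> is kept whole; a
  big one is represented by its part below some \<delta>, which accumulates at the rest.\<close>

lemma subspaces_density_le_lam: "subspaces_density_le X lam"
  unfolding subspaces_density_le_def
proof (intro allI impI)
  fix S assume "S \<subseteq> topspace X"
  then have S: "S \<subseteq> Field R" by (simp add: topspace_X)
  have "\<exists>D\<subseteq>{x \<in> S. lev x = m}. |D| \<le>o lam \<and>
      (\<forall>U \<beta>. openin X U \<longrightarrow> \<beta> \<in> U \<longrightarrow> \<beta> \<in> S \<longrightarrow> lev \<beta> = m \<longrightarrow> U \<inter> D \<noteq> {})" for m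
  proof (cases "big {x \<in> S. lev x = m}")
    case False
    then show ?thesis by (intro exI[of _ "{x \<in> S. lev x = m}"]) auto
  next
    case True
    show ?thesis
    proof (rule big_accumulates[OF _ True, of m])
      fix \<delta> assume \<delta>: "\<delta> \<in> Field R" "\<And>U \<beta>. openin X U \<Longrightarrow> \<beta> \<in> U \<Longrightarrow> \<not> \<beta> \<lhd> \<delta> \<Longrightarrow> m \<le> lev \<beta> \<Longrightarrow>
          U \<inter> {x \<in> S. lev x = m} \<inter> underS R \<delta> \<noteq> {}"
      let ?D = "{x \<in> S. lev x = m} \<inter> underS R \<delta>"
      have "U \<inter> ?D \<noteq> {}" if "openin X U" "\<beta> \<in> U" "\<beta> \<in> S" "lev \<beta> = m" for U \<beta>
        using \<delta>(2)[OF that(1,2)] that by (cases "\<beta> \<lhd> \<delta>") auto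
      moreover have "|?D| \<le>o lam" using ordLeq_subset[OF underS_ordLeq[OF \<delta>(1)]] by blast
      ultimately show ?thesis by (intro exI[of _ ?D]) auto
    qed (use S in auto)
  qed
  then obtain D where D: "\<And>m. D m \<subseteq> {x \<in> S. lev x = m}" "\<And>m. |D m| \<le>o lam"
    "\<And>m U \<beta>. openin X U \<Longrightarrow> \<beta> \<in> U \<Longrightarrow> \<beta> \<in> S \<Longrightarrow> lev \<beta> = m \<Longrightarrow> U \<inter> D m \<noteq> {}"
    by metis
  define D' where "D' = (\<Union>m. D m)"
  have sub: "D' \<subseteq> S" using D(1) unfolding D'_def by blast
  have "S \<subseteq> X closure_of D'"
  proof
    fix \<beta> assume \<beta>: "\<beta> \<in> S"
    show "\<beta> \<in> X closure_of D'"
      unfolding in_closure_of topspace_X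
    proof (intro conjI allI impI)
      fix T assume "\<beta> \<in> T \<and> openin X T"
      then have "T \<inter> D (lev \<beta>) \<noteq> {}" using D(3) \<beta> by blast
      then show "\<exists>y. y \<in> D' \<and> y \<in> T" unfolding D'_def by blast
    qed (use \<beta> S in auto)
  qed
  then have "subtopology X S closure_of D' = S"
    using sub by (auto simp: closure_of_subtopology Int_absorb1)
  moreover have "|D'| \<le>o lam" unfolding D'_def by (intro ordLeq_UN countable_ordLeq D(2))
  ultimately show "\<exists>D\<subseteq>S. subtopology X S closure_of D = S \<and> |D| \<le>o lam" using sub by blast
qed

lemma has_hereditary_density_X: "has_hereditary_density X lam"
  unfolding has_hereditary_density_def
proof (intro conjI allI impI subspaces_density_le_lam)
  show "cinfinite lam" "Card_order lam" using Cinf by auto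
  fix \<mu> :: "'a rel" assume \<mu>: "Cinfinite \<mu> \<and> subspaces_density_le X \<mu>"
  show "lam \<le>o \<mu>"
  proof (rule ccontr)
    assume "\<not> lam \<le>o \<mu>"
    then have less: "\<mu> <o lam"
      using \<mu> Card_order_lam card_order_on_well_order_on ordLess_or_ordLeq by blast
    \<comment> \<open>A subspace of size \<lambda> has no smaller dense subset, because sets with
      fewer than \<lambda> points are closed.\<close>
    obtain S where S: "S \<subseteq> Field R" "|S| =o lam" using big_subset[OF big_Field] by blast
    then obtain D where D: "D \<subseteq> S" "subtopology X S closure_of D = S" "|D| \<le>o \<mu>"
      using \<mu> unfolding subspaces_density_le_def topspace_X by blast
    have sm: "small D" using D(3) less by (rule ordLeq_ordLess_trans)
    then have "closedin X D" using closedin_small D(1) S(1) by blast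
    then have "subtopology X S closure_of D = D"
      using D(1) by (simp add: closure_of_subtopology Int_absorb1 closure_of_closedin)
    then have "small S" using D(2) sm by simp
    then show False using not_ordLess_ordIso S(2) by blast
  qed
qed

lemma subcovers_le_card: "|Field R| \<le>o \<nu> \<Longrightarrow> subcovers_le X \<nu>"
  unfolding subcovers_le_def topspace_X
proof (intro allI impI)
  fix \<U> assume \<nu>: "|Field R| \<le>o \<nu>" and U: "(\<forall>U\<in>\<U>. openin X U) \<and> \<Union>\<U> = Field R"
  then have "\<forall>x\<in>Field R. \<exists>U. U \<in> \<U> \<and> x \<in> U" by blast
  from bchoice[OF this] obtain f where f: "\<forall>x\<in>Field R. f x \<in> \<U> \<and> x \<in> f x" by blast
  have "|f ` Field R| \<le>o \<nu>" using card_of_image \<nu> by (rule ordLeq_transitive)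
  moreover have "\<Union>(f ` Field R) = Field R" using f U by blast
  ultimately show "\<exists>\<V>\<subseteq>\<U>. \<Union>\<V> = Field R \<and> |\<V>| \<le>o \<nu>" using f by (intro exI[of _ "f ` Field R"]) auto
qed

text \<open>At most \<lambda> many initial segments, each of size at most \<lambda>, cannot cover
  all points.\<close>

lemma subcovers_le_not_ordLeq:
  assumes "subcovers_le X \<mu>"
  shows "\<not> \<mu> \<le>o lam"
proof
  assume \<mu>: "\<mu> \<le>o lam"
  have "\<exists>\<delta>\<in>Field R. x \<lhd> \<delta>" if "x \<in> Field R" for x
    using bounded[OF _ ordLess_imp_ordLeq[OF ordLess_singleton[OF Cinf, of x]]] that by simp
  then have "\<Union>(underS R ` Field R) = Field R" using prec_Field(1) by blast
  moreover have "\<forall>U\<in>underS R ` Field R. openin X U" using openin_underS by blast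
  ultimately obtain \<V> where V: "\<V> \<subseteq> underS R ` Field R" "\<Union>\<V> = Field R" "|\<V>| \<le>o \<mu>"
    using assms[unfolded subcovers_le_def topspace_X, THEN spec, of "underS R ` Field R"] by auto
  have "|\<Union>V\<in>\<V>. V| \<le>o lam"
  proof (rule ordLeq_UN)
    show "|\<V>| \<le>o lam" using V(3) \<mu> by (rule ordLeq_transitive)
  qed (use V(1) underS_ordLeq in auto)
  then show False using big_Field V(2) by simp
qed

end

section \<open>Realising the assumptions from the guessing principle\<close>

text \<open>For boundedness, the union of the closed initial segments up to points of
  \<open>S\<close> has size at most \<lambda>, so it misses some \<delta>.\<close>

lemma regular_order_cardSuc:
  assumes lam: "Cinfinite lam" "regularCard lam"
  shows "regular_order lam (cardSuc lam)"
proof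
  let ?R = "cardSuc lam"
  have co: "Card_order lam" using lam by blast
  show wo: "Well_order ?R" using cardSuc_Well_order[OF co] .
  have le: "|A| <o ?R \<longleftrightarrow> |A| \<le>o lam" for A :: "'b set"
    using cardSuc_ordLeq_ordLess[OF co card_of_Card_order] .
  show under: "|under ?R x| \<le>o lam" if "x \<in> Field ?R" for x
    using card_of_under_ordLess[OF Cinfinite_cardSuc[OF lam(1)] that] le by blast
  show "\<exists>\<delta>\<in>Field ?R. S \<subseteq> underS ?R \<delta>" if S: "S \<subseteq> Field ?R" "|S| \<le>o lam" for S
  proof -
    have "|\<Union>s\<in>S. under ?R s| \<le>o lam"
      using UNION_Cinfinite_bound[OF S(2) _ lam(1)] under S(1) by blast
    moreover have "\<not> |Field ?R| \<le>o lam"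
      using le card_of_Field_ordIso[OF cardSuc_Card_order[OF co]] not_ordLess_ordIso by blast
    ultimately have "\<not> Field ?R \<subseteq> (\<Union>s\<in>S. under ?R s)" using ordLeq_subset by blast
    then obtain \<delta> where d: "\<delta> \<in> Field ?R" "\<delta> \<notin> (\<Union>s\<in>S. under ?R s)" by blast
    have "s \<in> underS ?R \<delta>" if "s \<in> S" for s
    proof -
      have "(\<delta>, s) \<notin> ?R" using d(2) that by (auto simp: under_def)
      moreover have "s \<in> Field ?R" using that S(1) by blast
      moreover have tot: "total_on (Field ?R) ?R" and refl: "refl_on (Field ?R) ?R"
        using wo by (simp_all add: well_order_on_def linear_order_on_def partial_order_on_def
            preorder_on_def)
      moreover have "s \<noteq> \<delta>" using \<open>(\<delta>, s) \<notin> ?R\<close> refl_onD[OF refl d(1)] by blast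
      ultimately show ?thesis
        using d(1) tot[unfolded total_on_def, rule_format, of \<delta> s] by (auto simp: underS_def)
    qed
    then show ?thesis using d(1) by blast
  qed
qed (use lam in auto)

text \<open>Levels are the second coordinates under a bijection between \<open>S\<close> and its
  product with the natural numbers.\<close>

lemma ex_levels:
  assumes "infinite S"
  obtains lev :: "'p \<Rightarrow> nat" where "\<And>n. |S| \<le>o |{x \<in> S. lev x = n}|"
proof -
  have "|UNIV::nat set| \<le>o |S|"
    using infinite_iff_natLeq_ordLeq assms card_of_nat ordIso_ordLeq_trans by blast
  then have "|S| =o |S \<times> (UNIV::nat set)|"
    using card_of_Times_infinite_simps(2)[OF assms] by blast
  then obtain f where f: "bij_betw f S (S \<times> (UNIV::nat set))" using card_of_ordIso by blast
  show thesis
  proof (rule that[of "\<lambda>x. snd (f x)"])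
    fix n
    let ?g = "\<lambda>x. inv_into S f (x, n)"
    have im: "f ` S = S \<times> UNIV" using f by (auto simp: bij_betw_def)
    have fg: "f (?g x) = (x, n)" if "x \<in> S" for x
      by (rule f_inv_into_f) (use that im in auto)
    show "|S| \<le>o |{x \<in> S. snd (f x) = n}|"
    proof (rule card_of_ordLeqI[of ?g])
      show "inj_on ?g S" by (rule inj_onI) (metis fg prod.inject)
      show "?g x \<in> {x \<in> S. snd (f x) = n}" if "x \<in> S" for x
        using fg[OF that] inv_into_into[of "(x, n)" f S] im that by auto
    qed
  qed
qed

context regular_order
begin

lemma club_in_final_segment:
  assumes "\<delta> \<in> Field R"
  shows "club_in R {x \<in> Field R. \<not> x \<lhd> \<delta>}"
  unfolding club_in_def
proof (intro conjI allI impI)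
  let ?C = "{x \<in> Field R. \<not> x \<lhd> \<delta>}"
  show "ord_sup R ?C = Field R"
  proof
    show "ord_sup R ?C \<subseteq> Field R" unfolding ord_sup_def using prec_Field by blast
    show "Field R \<subseteq> ord_sup R ?C"
    proof
      fix x assume "x \<in> Field R"
      moreover have "|{x, \<delta>}| \<le>o lam"
        using ordLess_imp_ordLeq[OF small_Un[OF ordLess_singleton[OF Cinf, of x]
            ordLess_singleton[OF Cinf, of \<delta>]]]
        by (simp add: insert_commute)
      ultimately obtain y where y: "y \<in> Field R" "{x, \<delta>} \<subseteq> underS R y"
        using bounded[of "{x, \<delta>}"] assms by blast
      then have "\<not> y \<lhd> \<delta>" using prec_trans prec_irrefl by blast
      then show "x \<in> ord_sup R ?C" using y unfolding ord_sup_def by blast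
    qed
  qed
  fix \<eta> assume \<eta>: "nonzero_limit R \<eta> \<and> ord_sup R (?C \<inter> underS R \<eta>) = underS R \<eta>"
  show "\<eta> \<in> ?C"
  proof (rule ccontr)
    assume n: "\<eta> \<notin> ?C"
    have "\<eta> \<in> Field R" "underS R \<eta> \<noteq> {}" using \<eta> unfolding nonzero_limit_def by auto
    then have "\<eta> \<lhd> \<delta>" using n by blast
    \<comment> \<open>Below \<delta> the segment is empty and so is its supremum, whereas \<eta> is
      nonzero.\<close>
    then have "?C \<inter> underS R \<eta> = {}" using prec_trans by blast
    then show False using \<eta> \<open>underS R \<eta> \<noteq> {}\<close> by (simp add: ord_sup_def)
  qed
qed auto

text \<open>A set of size at most \<lambda> is bounded, so it misses the club of all points from
  some \<delta> on.\<close>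

lemma stationary_in_big:
  assumes "stationary_in R S"
  shows "big S"
proof
  assume "|S| \<le>o lam"
  moreover have "S \<subseteq> Field R" using assms unfolding stationary_in_def by blast
  ultimately obtain \<delta> where "\<delta> \<in> Field R" "S \<subseteq> underS R \<delta>" using bounded by blast
  then show False
    using club_in_final_segment[of \<delta>] assms unfolding stationary_in_def by blast
qed

text \<open>A small set is not cofinal even in the non-strict sense, so a point it fails to reach is
  a strict bound.\<close>

lemma has_cofinality_small_bounded:
  assumes cof: "has_cofinality R \<alpha> lam" and S: "S \<subseteq> underS R \<alpha>" "small S"
  shows "\<exists>\<eta>\<in>underS R \<alpha>. S \<subseteq> underS R \<eta>"
proof -
  have "\<not> cofinal_below R \<alpha> S"
    using cof S(2) not_ordLess_ordLeq unfolding has_cofinality_def by blast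
  then obtain \<eta> where \<eta>: "\<eta> \<lhd> \<alpha>" "\<And>\<gamma>. \<gamma> \<in> S \<Longrightarrow> (\<eta>, \<gamma>) \<notin> R"
    unfolding cofinal_below_def using S(1) by blast
  have "\<gamma> \<lhd> \<eta>" if "\<gamma> \<in> S" for \<gamma>
  proof -
    have "\<gamma> \<in> Field R" "\<eta> \<in> Field R" using that S(1) \<eta>(1) prec_Field by blast+
    moreover have "\<not> \<eta> \<lhd> \<gamma>" "\<eta> \<noteq> \<gamma>"
      using \<eta>(2)[OF that] under_eq[of \<gamma>] calculation by (auto simp: underS_def under_def)
    ultimately show ?thesis using prec_linear by blast
  qed
  then show ?thesis using \<eta>(1) by blast
qed

text \<open>As \<lambda> is infinite, the empty set and singletons are strictly bounded. This
  releases the clause on ladders, which is stated only for nonzero limits.\<close>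

lemma nonzero_limit_if_has_cofinality:
  assumes "\<alpha> \<in> Field R" "has_cofinality R \<alpha> lam"
  shows "nonzero_limit R \<alpha>"
  unfolding nonzero_limit_def
proof (intro conjI ballI)
  show "underS R \<alpha> \<noteq> {}" using has_cofinality_small_bounded[OF assms(2) _ small_empty] by blast
  fix \<beta> assume "\<beta> \<lhd> \<alpha>"
  then show "\<exists>\<gamma>\<in>underS R \<alpha>. \<beta> \<lhd> \<gamma>"
    using has_cofinality_small_bounded[OF assms(2) _ ordLess_singleton[OF Cinf], of \<beta>] by blast
qed (rule assms(1))

end

lemma guessing_ladders_of_clubsuit_AD:
  assumes lam: "Cinfinite lam" "regularCard lam" and club: "clubsuit_AD lam"
  obtains \<A> lev where "guessing_ladders lam (cardSuc lam) (E_cof lam) \<A> lev"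
proof -
  let ?R = "cardSuc lam" and ?E = "E_cof lam"
  have co: "Card_order lam" using lam by blast
  interpret regular_order lam ?R by (rule regular_order_cardSuc[OF lam])
  obtain \<A> where AD: "AD_multi_ladder_system ?R ?E \<A>"
    and card: "\<And>\<alpha>. \<alpha> \<in> ?E \<Longrightarrow> |\<A> \<alpha>| =o lam"
    and stat: "\<And>B. B \<subseteq> Field ?R \<Longrightarrow> |B| =o ?R \<Longrightarrow> stationary_in ?R
             {\<alpha> \<in> ?E. \<forall>A\<in>\<A> \<alpha>. ord_sup ?R (A \<inter> B) = underS ?R \<alpha>}"
    using club unfolding clubsuit_AD_def by blast
  have E: "\<alpha> \<in> Field ?R" "has_cofinality ?R \<alpha> lam" if "\<alpha> \<in> ?E" for \<alpha>
    using that unfolding E_cof_def by auto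
  have lim: "nonzero_limit ?R \<alpha>" if "\<alpha> \<in> ?E" for \<alpha>
    using nonzero_limit_if_has_cofinality E that by blast
  have cofinal: "cofinal_below ?R \<alpha> A" if "\<alpha> \<in> ?E" "A \<in> \<A> \<alpha>" for \<alpha> A
    using AD lim[OF that(1)] that unfolding AD_multi_ladder_system_def by blast
  have Field: "|Field ?R| =o ?R" using card_of_Field_ordIso[OF cardSuc_Card_order[OF co]] .
  have le: "|A| <o ?R \<longleftrightarrow> |A| \<le>o lam" for A :: "'b set"
    using cardSuc_ordLeq_ordLess[OF co card_of_Card_order] .
  have bigF: "big (Field ?R)" using le Field not_ordLess_ordIso by blast
  have "infinite (Field ?R)" using Cinfinite_cardSuc[OF lam(1)] by (simp add: cinfinite_def)
  then obtain lev where lev: "\<And>n::nat. |Field ?R| \<le>o |{x \<in> Field ?R. lev x = n}|"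
    using ex_levels by blast
  show thesis
  proof (rule that, unfold_locales)
    show "?E \<subseteq> Field ?R" using E(1) by blast
    show "\<exists>\<eta>\<in>underS ?R \<alpha>. S \<subseteq> underS ?R \<eta>" if "\<alpha> \<in> ?E" "S \<subseteq> underS ?R \<alpha>" "small S" for \<alpha> S
      by (rule has_cofinality_small_bounded[OF E(2)[OF that(1)] that(2,3)])
    show "|\<A> \<alpha>| =o lam" if "\<alpha> \<in> ?E" for \<alpha> by (rule card[OF that])
    show sub: "A \<subseteq> underS ?R \<alpha>" if "\<alpha> \<in> ?E" "A \<in> \<A> \<alpha>" for \<alpha> A
      using cofinal[OF that] unfolding cofinal_below_def by blast
    show "\<not> A \<subseteq> underS ?R \<eta>" if a: "\<alpha> \<in> ?E" "A \<in> \<A> \<alpha>" "\<eta> \<in> underS ?R \<alpha>" for \<alpha> A \<eta>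
    proof
      assume "A \<subseteq> underS ?R \<eta>"
      moreover obtain \<gamma> where "\<gamma> \<in> A" "(\<eta>, \<gamma>) \<in> ?R"
        using cofinal[OF a(1,2)] a(3) unfolding cofinal_below_def by blast
      ultimately have "\<gamma> \<in> underS ?R \<eta>" "\<eta> = \<gamma> \<or> \<eta> \<in> underS ?R \<gamma>" by (auto simp: underS_def)
      then show False using prec_trans prec_irrefl by blast
    qed
    show "\<exists>\<eta>\<in>underS ?R \<alpha>. A \<inter> A' \<subseteq> underS ?R \<eta>"
      if a: "\<alpha> \<in> ?E" "\<alpha>' \<in> ?E" "A \<in> \<A> \<alpha>" "A' \<in> \<A> \<alpha>'" "A \<noteq> A'" for \<alpha> \<alpha>' A A'
    proof -
      have "ord_sup ?R (A \<inter> A') \<subset> ord_sup ?R A"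
        using AD a unfolding AD_multi_ladder_system_def by blast
      then obtain \<eta> a where \<eta>: "a \<in> A" "\<eta> \<in> underS ?R a" "\<And>b. b \<in> A \<inter> A' \<Longrightarrow> \<eta> \<notin> underS ?R b"
        unfolding ord_sup_def by blast
      have "\<eta> \<in> underS ?R \<alpha>" using \<eta>(1,2) sub[OF a(1,3)] prec_trans by blast
      \<comment> \<open>The points of the intersection may equal \<eta>, so a strict bound has to be
        taken above it.\<close>
      then obtain \<zeta> where z: "\<zeta> \<in> underS ?R \<alpha>" "\<eta> \<in> underS ?R \<zeta>" using lim[OF a(1)] unfolding nonzero_limit_def by blast
      have "b \<in> underS ?R \<zeta>" if "b \<in> A \<inter> A'" for b
      proof -
        have "b \<in> Field ?R" using that sub[OF a(1,3)] prec_Field(1) by blast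
        then show ?thesis using prec_linear[of b \<eta>] \<eta>(3)[OF that] prec_Field(1)[OF z(2)] z(2) prec_trans
          by blast
      qed
      then show ?thesis using z(1) by blast
    qed
    show "big {\<alpha> \<in> ?E. \<forall>A\<in>\<A> \<alpha>. \<forall>\<eta>\<in>underS ?R \<alpha>. \<not> A \<inter> B \<subseteq> underS ?R \<eta>}"
      if B: "B \<subseteq> Field ?R" "big B" for B
    proof -
      have "|B| =o ?R"
      proof -
        have "|B| \<le>o ?R" using card_of_mono1[OF B(1)] Field ordLeq_ordIso_trans by blast
        then show ?thesis using le B(2) ordLeq_iff_ordLess_or_ordIso by blast
      qed
      from stationary_in_big[OF stat[OF B(1) this]] show ?thesis
      proof (rule contrapos_nn, elim ordLeq_subset, intro subsetI, simp, intro ballI notI)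
        fix \<alpha> A \<eta>
        assume "\<alpha> \<in> ?E \<and> (\<forall>A\<in>\<A> \<alpha>. ord_sup ?R (A \<inter> B) = underS ?R \<alpha>)"
          and "A \<in> \<A> \<alpha>" "\<eta> \<in> underS ?R \<alpha>" and sub: "A \<inter> B \<subseteq> underS ?R \<eta>"
        \<comment> \<open>As the supremum is \<alpha>, some point of \<open>A \<inter> B\<close>
          lies above \<eta>, against the supposed bound.\<close>
        then have "\<eta> \<in> ord_sup ?R (A \<inter> B)" by blast
        then show False using sub prec_trans prec_irrefl unfolding ord_sup_def by blast
      qed
    qed
    show "big {x \<in> Field ?R. lev x = n}" for n
      using lev[of n] bigF ordLeq_transitive by blast
  qed
qed

theorem theorem4p13:
  fixes lam :: "'a rel"
  assumes "Cinfinite lam"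
    and "regularCard lam"
    and "clubsuit_AD lam"
  shows "\<exists>X :: 'a set topology.
           t1_space X \<and> Hausdorff_space X \<and>
           collectionwise_normal X \<and> Dowker_space X \<and>
           |topspace X| =o cardSuc lam \<and>
           has_hereditary_density X lam \<and>
           has_Lindelof_degree X (cardSuc lam)"
proof -
  have co: "Card_order lam" using assms by blast
  obtain \<A> lev where gl: "guessing_ladders lam (cardSuc lam) (E_cof lam) \<A> lev"
    by (rule guessing_ladders_of_clubsuit_AD[OF assms])
  interpret guessing_ladders lam "cardSuc lam" "E_cof lam" \<A> lev by (rule gl)
  obtain e G where "ladder_space lam (cardSuc lam) (E_cof lam) \<A> lev e G"
    using ex_ladder_space by blast
  then interpret ladder_space lam "cardSuc lam" "E_cof lam" \<A> lev e G .
  have card: "|topspace X| =o cardSuc lam"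
    unfolding topspace_X by (rule card_of_Field_ordIso[OF cardSuc_Card_order[OF co]])
  have "has_Lindelof_degree X (cardSuc lam)"
    unfolding has_Lindelof_degree_def
  proof (intro conjI allI impI)
    show "cinfinite (cardSuc lam)" "Card_order (cardSuc lam)"
      using Cinfinite_cardSuc[OF assms(1)] by auto
    show "subcovers_le X (cardSuc lam)"
      by (rule subcovers_le_card) (use card topspace_X ordIso_imp_ordLeq in auto)
    fix \<mu> :: "'a set rel" assume \<mu>: "Cinfinite \<mu> \<and> subcovers_le X \<mu>"
    \<comment> \<open>A cardinal below \<open>\<lambda>\<^sup>+\<close> is at most \<lambda>, where
      the cover by initial segments has no subcover that small.\<close>
    then have "\<not> \<mu> <o cardSuc lam"
      using subcovers_le_not_ordLeq[of \<mu>] cardSuc_ordLeq_ordLess[OF co, of \<mu>] by blast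
    then show "cardSuc lam \<le>o \<mu>"
      using \<mu> card_order_on_well_order_on cardSuc_Well_order[OF co] ordLess_or_ordLeq by blast
  qed
  then show ?thesis
    using t1_space_X Hausdorff_space_X collectionwise_normal_X Dowker_space_X card
      has_hereditary_density_X by blast
qed

end
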